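(* Let $(A_n)_{n\ge0}$ be the discrete-time diffusion limited aggregation on $\mathcal{H}$ and $h_n=\max_{x\in A_n}\{x_2\}$. For every $\epsilon>0$, with probability one, $$\limsup_{n\to\infty}n^{-\epsilon-2/3}h_n=0.$$
   Context: $\mathcal{H}=\{(x_1,x_2)\in\mathbb{Z}^2: x_2\ge 0\}$; points are written $x=(x_1,x_2)$; $L_n=\{(k,n):k\in\mathbb{Z}\}$ for integers $n\ge 0$. $(S_n)_{n\ge 0}$ is simple random walk on $\mathbb{Z}^2$, $P_z$ is its law when $S_0=z$, and for $A\subset\mathbb{Z}^2$, $\bar\tau_A=\min\{n\ge 0:S_n\in A\}$. For $B\subset\mathcal{H}$ and an oriented nearest-neighbor edge $\vec e=x\to y$ with $x\in B$, $y\in\mathcal{H}\setminus B$, let $$H_{B,N}(\vec e)=\sum_{z\in L_N\setminus B}P_z\big(S_{\bar\tau_{B\cup L_0}}=x,\ S_{\bar\tau_{B\cup L_0}-1}=y\big),\qquad H_B(\vec e)=\lim_{N\to\infty}H_{B,N}(\vec e)$$ (the limit exists and is finite). Let $\partial^{out}B$ be the set of points of $\mathcal H\setminus B$ having a nearest neighbor in $B$. For $y\in\partial^{out}B$ let $\hat H_B(y)=\sum_{\vec e}H_B(\vec e)$, the sum over edges $\vec e$ starting in $B$ and ending at $y$ (and $\hat H_B(y)=0$ for other $y$). For finite $B$, $H_B=\sum_{y\in\partial^{out}B}\hat H_B(y)$. The discrete process is the Markov chain on finite subsets of $\mathcal{H}$ with $A_0=\{(0,0)\}$ and $A_{n+1}=A_n\cup\{y\}$,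 where, given $A_n$, the point $y\in\partial^{out}A_n$ is sampled with probability $\tilde p(A_n,y)=\hat H_{A_n}(y)/H_{A_n}$. *)

theory Defs
  imports "HOL-Probability.Probability"
begin

type_synonym point = "int \<times> int"

definition half_plane :: "point set" where
  "half_plane = {x. snd x \<ge> 0}"

definition line :: "nat \<Rightarrow> point set" where
  "line n = {x. snd x = int n}"

definition neighbors :: "point \<Rightarrow> point \<Rightarrow> bool" where
  "neighbors x y \<longleftrightarrow> \<bar>fst x - fst y\<bar> + \<bar>snd x - snd y\<bar> = 1"

definition srw_step :: "point pmf" where
  "srw_step = pmf_of_set {(1, 0), (-1, 0), (0, 1), (0, -1)}"

definition srw_space :: "(nat \<Rightarrow> point) measure" where
  "srw_space = (\<Pi>\<^sub>M i\<in>UNIV. measure_pmf srw_step)"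

text \<open>The law \<open>P\<^sub>z\<close> is the law of \<open>srw z\<close> under \<open>srw_space\<close>.\<close>

definition srw :: "point \<Rightarrow> (nat \<Rightarrow> point) \<Rightarrow> nat \<Rightarrow> point" where
  "srw z \<xi> n = z + (\<Sum>i<n. \<xi> i)"

definition hitting_time :: "point set \<Rightarrow> (nat \<Rightarrow> point) \<Rightarrow> enat" where
  "hitting_time A S = Inf (enat ` {n. S n \<in> A})"

text \<open>An oriented edge is the pair of its initial point in \<open>B\<close> and its endpoint outside \<open>B\<close>;
  the walk traverses it backwards when it enters \<open>B\<close>. The event below excludes hitting time 0,
  for which the previous position of the walk is undefined; this occurs only for \<open>N = 0\<close>.\<close>

definition harmonic_edge_level :: "point set \<Rightarrow> nat \<Rightarrow> point \<times> point \<Rightarrow> ennreal" where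
  "harmonic_edge_level B N = (\<lambda>(x, y).
     (\<Sum>\<^sub>\<infinity>z\<in>line N - B.
        ennreal (\<P>(\<xi> in srw_space. \<exists>m. hitting_time (B \<union> line 0) (srw z \<xi>) = enat (Suc m) \<and>
                                    srw z \<xi> (Suc m) = x \<and> srw z \<xi> m = y))))"

definition harmonic_edge :: "point set \<Rightarrow> point \<times> point \<Rightarrow> ennreal" where
  "harmonic_edge B e = lim (\<lambda>N. harmonic_edge_level B N e)"

definition outer_boundary :: "point set \<Rightarrow> point set" where
  "outer_boundary B = {y \<in> half_plane - B. \<exists>x\<in>B. neighbors x y}"

definition harmonic_point :: "point set \<Rightarrow> point \<Rightarrow> ennreal" where
  "harmonic_point B y =
     (if y \<in> outer_boundary B then \<Sum>x\<in>{x \<in> B. neighbors x y}. harmonic_edge B (x, y) else 0)"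

definition harmonic_total :: "point set \<Rightarrow> ennreal" where
  "harmonic_total B = (\<Sum>y\<in>outer_boundary B. harmonic_point B y)"

definition attach_prob :: "point set \<Rightarrow> point \<Rightarrow> real" where
  "attach_prob B y = enn2real (harmonic_point B y / harmonic_total B)"

definition dla_process :: "'a measure \<Rightarrow> (nat \<Rightarrow> 'a \<Rightarrow> point set) \<Rightarrow> bool" where
  "dla_process M A \<longleftrightarrow>
     prob_space M \<and>
     (\<forall>n. A n \<in> M \<rightarrow>\<^sub>M count_space {B. finite B \<and> B \<subseteq> half_plane}) \<and>
     (AE \<omega> in M. A 0 \<omega> = {(0, 0)}) \<and>
     (\<forall>n B. \<P>(\<omega> in M. \<forall>i\<le>n. A i \<omega> = B i) > 0 \<longrightarrow>
        (\<forall>y\<in>outer_boundary (B n).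
           \<P>(\<omega> in M. A (Suc n) \<omega> = B n \<union> {y} \<bar> \<forall>i\<le>n. A i \<omega> = B i) = attach_prob (B n) y))"

definition cluster_height :: "point set \<Rightarrow> int" where
  "cluster_height B = Max (snd ` B)"

end

theory Submission
  imports Defs "HOL-Real_Asymp.Real_Asymp"
begin

text \<open>
  Reversing the walk at its last step identifies the weight of every edge ending at \<open>y\<close> with the
  escape potential \<open>V\<^sub>B y\<close>: the function that is harmonic off \<open>B \<union> L\<^sub>0\<close>, vanishes there and differs
  from the height by a bounded amount.

  Upper bound. For points \<open>y\<^sub>0, ..., y\<^sub>h\<close> of a nearest-neighbour path let \<open>u\<^sub>k\<close> solve the Dirichlet
  problem, in a box of radius \<open>2 h\<close> around \<open>y\<^sub>h\<close>, with the height as boundary value and zero on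
  \<open>y\<^sub>0, ..., y\<^sub>k\<close>. By orthogonality the energy of \<open>u\<^sub>k\<close> exceeds that of \<open>u\<^sub>k\<^sub>-\<^sub>1\<close> by at least
  \<open>(u\<^sub>k\<^sub>-\<^sub>1 y\<^sub>k)\<^sup>2\<close>, since \<open>u\<^sub>k\<^sub>-\<^sub>1\<close> vanishes at the neighbour \<open>y\<^sub>k\<^sub>-\<^sub>1\<close> of \<open>y\<^sub>k\<close>. All energies are
  \<open>O(h\<^sup>2)\<close>, so the escape potentials along the path have mean square \<open>O(h)\<close>: an averaged form of
  Beurling's estimate that suffices here.

  Lower bound. If \<open>B\<close> has height \<open>h\<close>, then \<open>height - V\<^sub>B\<close> has energy at most \<open>h\<close> times the total
  measure, and it climbs from \<open>0\<close> on \<open>L\<^sub>0\<close> to \<open>h\<close> at the top point, which costs energy at least of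
  order \<open>h\<^sup>2 / ln h\<close>. Hence the total measure is at least of order \<open>h / ln h\<close>.

  As in Kesten's argument, a cluster of height \<open>2 h\<close> contains a path of \<open>h\<close> successively attached
  points at height at least \<open>h\<close>. A given path occurs by time \<open>n\<close> with probability at most
  \<open>(n choose h)\<close> times the product of its attachment probabilities. By the inequality of arithmetic
  and geometric means this is at most \<open>(C n ln h / h\<^sup>3\<^sup>/\<^sup>2)\<^sup>h\<close>, which is summable for
  \<open>h\<close> of order \<open>n\<^sup>2\<^sup>/\<^sup>3\<^sup>+\<^sup>\<epsilon>\<^sup>/\<^sup>2\<close>.
\<close>

section \<open>Killed averaging and the escape potential\<close>

definition avg :: "(point \<Rightarrow> real) \<Rightarrow> point \<Rightarrow> real" where
  "avg f z = (f (z + (1, 0)) + f (z + (-1, 0)) + f (z + (0, 1)) + f (z + (0, -1))) / 4"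

text \<open>\<open>(kill K ^^ m) f z\<close> is the expectation of \<open>f\<close> at time
  \<open>m\<close> for the walk from \<open>z\<close>, restricted to the event that it avoids
  \<open>K\<close> at the times \<open>0, ..., m - 1\<close>.\<close>

definition kill :: "point set \<Rightarrow> (point \<Rightarrow> real) \<Rightarrow> point \<Rightarrow> real" where
  "kill K f z = (if z \<in> K then 0 else avg f z)"

definition ht :: "point \<Rightarrow> real" where
  "ht z = real_of_int (max 0 (snd z))"

definition ht_off :: "point set \<Rightarrow> point \<Rightarrow> real" where
  "ht_off K z = (if z \<in> K then 0 else ht z)"

definition escape :: "point set \<Rightarrow> point \<Rightarrow> real" where
  "escape K z = lim (\<lambda>m. (kill K ^^ m) (ht_off K) z)"

abbreviation absorbing :: "point set \<Rightarrow> point set" where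
  "absorbing B \<equiv> B \<union> line 0"

lemma avg_mono: "(\<And>z. f z \<le> g z) \<Longrightarrow> avg f z \<le> avg g z"
  unfolding avg_def by (intro divide_right_mono add_mono) auto

lemma kill_mono: "(\<And>z. f z \<le> g z) \<Longrightarrow> kill K f z \<le> kill K g z"
  unfolding kill_def using avg_mono[of f g] by auto

lemma kill_pow_Suc: "(kill K ^^ Suc m) f z = (if z \<in> K then 0 else avg ((kill K ^^ m) f) z)"
  by (simp add: kill_def)

lemma avg_linear: "avg (\<lambda>z. a * f z + b * g z) z = a * avg f z + b * avg g z"
  by (simp add: avg_def algebra_simps add_divide_distrib)

lemma avg_nonneg: "(\<And>z. 0 \<le> f z) \<Longrightarrow> 0 \<le> avg f z"
  by (simp add: avg_def)

lemma kill_pow_mono: "(\<And>z. f z \<le> g z) \<Longrightarrow> (kill K ^^ m) f z \<le> (kill K ^^ m) g z"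
  by (induction m arbitrary: z) (auto intro: kill_mono)

lemma kill_pow_nonneg: "(\<And>z. 0 \<le> f z) \<Longrightarrow> 0 \<le> (kill K ^^ m) f z"
  by (induction m arbitrary: z) (auto simp: kill_pow_Suc avg_nonneg simp del: funpow.simps(2))

lemma kill_pow_linear:
  "(kill K ^^ m) (\<lambda>z. a * f z + b * g z) z = a * (kill K ^^ m) f z + b * (kill K ^^ m) g z"
proof (induction m arbitrary: z)
  case (Suc m)
  then have "(kill K ^^ m) (\<lambda>z. a * f z + b * g z) = (\<lambda>z. a * (kill K ^^ m) f z + b * (kill K ^^ m) g z)"
    by auto
  then show ?case by (simp add: kill_pow_Suc avg_linear del: funpow.simps(2))
qed simp

lemma kill_pow_zero: "(kill K ^^ m) (\<lambda>z. 0) z = 0"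
  using kill_pow_linear[where a = 0 and b = 0] by simp

lemma kill_pow_diff:
  "(kill K ^^ m) (\<lambda>z. f z - g z) z = (kill K ^^ m) f z - (kill K ^^ m) g z"
  using kill_pow_linear[where a = 1 and b = "-1"] by simp

lemma kill_pow_sum:
  "(kill K ^^ m) (\<lambda>z. \<Sum>j\<in>J. f j z) z = (\<Sum>j\<in>J. (kill K ^^ m) (f j) z)"
proof (induction J rule: infinite_finite_induct)
  case (insert j J)
  then show ?case
    using kill_pow_linear[where a = 1 and b = 1 and f = "f j" and g = "\<lambda>z. \<Sum>j\<in>J. f j z"] by simp
qed (simp_all add: kill_pow_zero)

lemma funpow_Suc_inner: "(f ^^ Suc m) x = (f ^^ m) (f x)"
  by (simp add: funpow_swap1)

lemma kill_pow_antimono: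
  assumes "\<And>z. kill K f z \<le> f z"
  shows "(kill K ^^ Suc m) f z \<le> (kill K ^^ m) f z"
  unfolding funpow_Suc_inner by (rule kill_pow_mono) (rule assms)

lemma ht_nonneg [simp]: "0 \<le> ht z"
  by (simp add: ht_def)

lemma avg_ht: "snd z \<noteq> 0 \<Longrightarrow> avg ht z = ht z"
  by (cases z) (auto simp: avg_def ht_def max_def)

lemma kill_ht_off_le: "line 0 \<subseteq> K \<Longrightarrow> kill K (ht_off K) z \<le> ht_off K z"
proof -
  assume K: "line 0 \<subseteq> K"
  show ?thesis
  proof (cases "z \<in> K")
    case False
    then have "snd z \<noteq> 0" using K by (auto simp: line_def)
    then have "avg ht z = ht z" by (rule avg_ht)
    moreover have "avg (ht_off K) z \<le> avg ht z" by (rule avg_mono) (simp add: ht_off_def)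
    ultimately show ?thesis using False by (simp add: kill_def ht_off_def)
  qed (simp add: kill_def ht_off_def)
qed

lemma ht_off_nonneg: "0 \<le> ht_off K z"
  by (simp add: ht_off_def)

lemma kill_pow_ht_off_le:
  assumes "line 0 \<subseteq> K" "m \<le> n"
  shows "(kill K ^^ n) (ht_off K) z \<le> (kill K ^^ m) (ht_off K) z"
  using assms(2) by (rule lift_Suc_antimono_le[rotated]) (intro kill_pow_antimono kill_ht_off_le assms)

lemma escape_tendsto:
  assumes "line 0 \<subseteq> K"
  shows "(\<lambda>m. (kill K ^^ m) (ht_off K) z) \<longlonglongrightarrow> escape K z"
proof -
  have "monoseq (\<lambda>m. (kill K ^^ m) (ht_off K) z)"
    using kill_pow_ht_off_le[OF assms] by (intro decseq_imp_monoseq) (simp add: decseq_def)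
  moreover have "Bseq (\<lambda>m. (kill K ^^ m) (ht_off K) z)"
    using kill_pow_ht_off_le[OF assms, of 0] kill_pow_nonneg[of "ht_off K", OF ht_off_nonneg]
    by (intro BseqI'[of _ "ht_off K z"]) (auto simp: abs_of_nonneg)
  ultimately have "convergent (\<lambda>m. (kill K ^^ m) (ht_off K) z)"
    by (intro Bseq_monoseq_convergent)
  then show ?thesis unfolding escape_def by (simp add: convergent_LIMSEQ_iff)
qed

lemma escape_nonneg: "line 0 \<subseteq> K \<Longrightarrow> 0 \<le> escape K z"
  by (rule LIMSEQ_le_const[OF escape_tendsto]) (auto intro: kill_pow_nonneg ht_off_nonneg)

lemma escape_le_pow: "line 0 \<subseteq> K \<Longrightarrow> escape K z \<le> (kill K ^^ m) (ht_off K) z"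
  by (rule LIMSEQ_le_const2[OF escape_tendsto]) (auto intro: kill_pow_ht_off_le)

lemma escape_on: "line 0 \<subseteq> K \<Longrightarrow> z \<in> K \<Longrightarrow> escape K z = 0"
  using escape_le_pow[of K z 0] escape_nonneg[of K z] by (simp add: ht_off_def)

lemma escape_below: "line 0 \<subseteq> K \<Longrightarrow> snd z \<le> 0 \<Longrightarrow> escape K z = 0"
  using escape_le_pow[of K z 0] escape_nonneg[of K z] by (auto simp: ht_off_def ht_def split: if_splits)

lemma avg_tendsto:
  assumes "\<And>z. (\<lambda>m. f m z) \<longlonglongrightarrow> g z"
  shows "(\<lambda>m. avg (f m) z) \<longlonglongrightarrow> avg g z"
  unfolding avg_def by (intro tendsto_intros assms) simp

section \<open>Last-exit reversal\<close>

lemma nn_integral_shift: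
  "(\<integral>\<^sup>+z. ennreal (f z * g (z + s)) \<partial>count_space UNIV) =
   (\<integral>\<^sup>+z. ennreal (f (z + (- s)) * g z) \<partial>count_space (UNIV :: point set))"
proof -
  have "bij (\<lambda>z::point. z + (- s))"
    by (rule bijI', simp, metis add.assoc add.right_inverse add.right_neutral add.commute)
  from nn_integral_bij_count_space[OF this, of "\<lambda>z. ennreal (f z * g (z + s))"]
  show ?thesis by simp
qed

definition pairing :: "(point \<Rightarrow> real) \<Rightarrow> (point \<Rightarrow> real) \<Rightarrow> ennreal" where
  "pairing f g = (\<integral>\<^sup>+z. ennreal (f z * g z) \<partial>count_space UNIV)"

text \<open>Each of the four shifts is transposed by translation invariance of the counting measure,
  and the set of steps is symmetric.\<close>

lemma pairing_avg:
  assumes "\<And>z. 0 \<le> f z" "\<And>z. 0 \<le> g z"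
  shows "pairing f (avg g) = pairing (avg f) g"
proof -
  have split: "ennreal (a * ((b1 + b2 + b3 + b4) / 4)) = ennreal (1/4) * (ennreal (a * b1) + ennreal (a * b2) + ennreal (a * b3) + ennreal (a * b4))"
    if "0 \<le> a" "0 \<le> b1" "0 \<le> b2" "0 \<le> b3" "0 \<le> b4" for a b1 b2 b3 b4 :: real
    using that by (simp add: ennreal_plus[symmetric] ennreal_mult[symmetric] algebra_simps del: ennreal_plus)
  have "pairing f (avg g) = ennreal (1/4) *
     ((\<integral>\<^sup>+z. ennreal (f z * g (z + (1,0))) \<partial>count_space UNIV) + (\<integral>\<^sup>+z. ennreal (f z * g (z + (-1,0))) \<partial>count_space UNIV)
      + (\<integral>\<^sup>+z. ennreal (f z * g (z + (0,1))) \<partial>count_space UNIV) + (\<integral>\<^sup>+z. ennreal (f z * g (z + (0,-1))) \<partial>count_space UNIV))"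
  proof -
    have "pairing f (avg g) = (\<integral>\<^sup>+z. ennreal (1/4) * (ennreal (f z * g (z + (1,0))) + ennreal (f z * g (z + (-1,0)))
        + ennreal (f z * g (z + (0,1))) + ennreal (f z * g (z + (0,-1)))) \<partial>count_space UNIV)"
      unfolding pairing_def avg_def by (intro nn_integral_cong split assms)
    then show ?thesis by (simp add: nn_integral_add nn_integral_cmult)
  qed
  also have "\<dots> = ennreal (1/4) *
     ((\<integral>\<^sup>+z. ennreal (f (z + (1,0)) * g z) \<partial>count_space UNIV) + (\<integral>\<^sup>+z. ennreal (f (z + (-1,0)) * g z) \<partial>count_space UNIV)
      + (\<integral>\<^sup>+z. ennreal (f (z + (0,1)) * g z) \<partial>count_space UNIV) + (\<integral>\<^sup>+z. ennreal (f (z + (0,-1)) * g z) \<partial>count_space UNIV))"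
    unfolding nn_integral_shift by (simp add: ac_simps)
  also have "\<dots> = pairing (avg f) g"
  proof -
    have "pairing (avg f) g = (\<integral>\<^sup>+z. ennreal (g z * ((f (z + (1,0)) + f (z + (-1,0)) + f (z + (0,1)) + f (z + (0,-1))) / 4))
        \<partial>count_space UNIV)"
      unfolding pairing_def avg_def by (simp only: mult.commute)
    also have "\<dots> = (\<integral>\<^sup>+z. ennreal (1/4) * (ennreal (g z * f (z + (1,0))) + ennreal (g z * f (z + (-1,0)))
        + ennreal (g z * f (z + (0,1))) + ennreal (g z * f (z + (0,-1)))) \<partial>count_space UNIV)"
      by (intro nn_integral_cong split assms)
    finally show ?thesis by (simp add: nn_integral_add nn_integral_cmult mult.commute)
  qed
  finally show ?thesis .
qed

text \<open>The zeros of the other factor already remove the points of \<open>K\<close>, so the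
  killed step inherits the symmetry of the free one. Iterated, this is time reversal of the killed
  walk.\<close>

lemma pairing_kill:
  assumes "\<And>z. 0 \<le> f z" "\<And>z. 0 \<le> g z" "\<And>z. z \<in> K \<Longrightarrow> f z = 0" "\<And>z. z \<in> K \<Longrightarrow> g z = 0"
  shows "pairing f (kill K g) = pairing (kill K f) g"
proof -
  have "pairing f (kill K g) = pairing f (avg g)" unfolding pairing_def kill_def
    by (intro nn_integral_cong) (use assms(3) in auto)
  also have "\<dots> = pairing (avg f) g" by (rule pairing_avg) (use assms in auto)
  also have "\<dots> = pairing (kill K f) g" unfolding pairing_def kill_def
    by (intro nn_integral_cong) (use assms(4) in auto)
  finally show ?thesis .
qed

lemma pairing_kill_pow:
  assumes "\<And>z. 0 \<le> f z" "\<And>z. 0 \<le> g z" "\<And>z. z \<in> K \<Longrightarrow> f z = 0" "\<And>z. z \<in> K \<Longrightarrow> g z = 0"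
  shows "pairing f ((kill K ^^ m) g) = pairing ((kill K ^^ m) f) g"
  using assms
proof (induction m arbitrary: f)
  case (Suc m)
  have "pairing f ((kill K ^^ Suc m) g) = pairing (kill K f) ((kill K ^^ m) g)"
  proof (simp, rule pairing_kill)
    show "(kill K ^^ m) g z = 0" if "z \<in> K" for z
      using that Suc.prems(4) by (cases m) (auto simp: kill_def)
  qed (use Suc.prems in \<open>auto intro: kill_pow_nonneg\<close>)
  also have "\<dots> = pairing ((kill K ^^ m) (kill K f)) g"
    by (rule Suc.IH) (use Suc.prems in \<open>auto simp: kill_def avg_def\<close>)
  finally show ?case by (simp add: funpow_swap1)
qed simp

lemma pairing_point: "(\<And>z. 0 \<le> f z) \<Longrightarrow> pairing f (indicator {y}) = ennreal (f y)"
proof -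
  assume f: "\<And>z. 0 \<le> f z"
  have "pairing f (indicator {y}) = (\<integral>\<^sup>+z. ennreal (f z) * indicator {y} z \<partial>count_space UNIV)"
    unfolding pairing_def by (intro nn_integral_cong) (auto simp: indicator_def)
  then show ?thesis by simp
qed

section \<open>Expected visits to a line\<close>

definition line_off :: "point set \<Rightarrow> nat \<Rightarrow> point \<Rightarrow> real" where
  "line_off K N = indicator (line N - K)"

lemma kill_pow_line_off_summable:
  assumes K: "line 0 \<subseteq> K" and j: "0 < j"
  shows "summable (\<lambda>m. (kill K ^^ m) (line_off K j) y)"
proof -
  \<comment> \<open>Truncated at \<open>j\<close>, the height loses at least a quarter in the mean
    at each point of \<open>line j\<close> off \<open>K\<close>, so the decrease of the killed
    iterates of \<open>G\<close> pays for the visits.\<close>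
  define G where "G z = (if z \<in> K then 0 else min (ht z) j)" for z
  have Gnn: "0 \<le> G z" for z by (simp add: G_def)
  have step: "kill K G z \<le> G z - line_off K j z / 4" for z
  proof (cases "z \<in> K")
    case False
    then have z: "snd z \<noteq> 0" using K by (auto simp: line_def)
    have "avg G z \<le> avg (\<lambda>z. min (ht z) j) z" by (rule avg_mono) (simp add: G_def)
    also have "\<dots> = min (ht z) j - line_off K j z / 4"
    proof -
      obtain a b where ab: "z = (a, b)" by (cases z)
      consider "b < 0" | "0 < b" "b < int j" | "b = int j" | "int j < b" using z ab by fastforce
      then show ?thesis
        using z False j ab
        by cases (auto simp: avg_def ht_def line_off_def line_def indicator_def min_def)
    qed
    finally show ?thesis using False by (simp add: kill_def G_def)
  qed (simp add: kill_def G_def line_off_def)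
  have le: "line_off K j z \<le> 4 * G z + (-4) * kill K G z" for z
    using step[of z] by simp
  have pow: "(kill K ^^ m) (line_off K j) y \<le> 4 * ((kill K ^^ m) G y - (kill K ^^ Suc m) G y)" for m
  proof -
    have "(kill K ^^ m) (line_off K j) y \<le> (kill K ^^ m) (\<lambda>z. 4 * G z + (-4) * kill K G z) y"
      by (rule kill_pow_mono) (rule le)
    also have "\<dots> = 4 * ((kill K ^^ m) G y - (kill K ^^ Suc m) G y)"
      unfolding kill_pow_linear funpow_Suc_inner by simp
    finally show ?thesis .
  qed
  have "(\<Sum>m<M. (kill K ^^ m) (line_off K j) y) \<le> 4 * G y" for M
  proof -
    have "(\<Sum>m<M. (kill K ^^ m) (line_off K j) y) \<le> (\<Sum>m<M. 4 * ((kill K ^^ m) G y - (kill K ^^ Suc m) G y))"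
      by (intro sum_mono pow)
    also have "\<dots> = 4 * (G y - (kill K ^^ M) G y)"
      unfolding sum_distrib_left[symmetric] by (subst sum_lessThan_telescope') simp
    also have "\<dots> \<le> 4 * G y" using kill_pow_nonneg[of G M K y, OF Gnn] by simp
    finally show ?thesis .
  qed
  note bound = this
  show ?thesis
  proof (rule bounded_imp_summable)
    show "0 \<le> (kill K ^^ m) (line_off K j) y" for m
      by (rule kill_pow_nonneg) (simp add: line_off_def)
    show "(\<Sum>k\<le>n. (kill K ^^ k) (line_off K j) y) \<le> 4 * G y" for n
      using bound[of "Suc n"] by (simp only: lessThan_Suc_atMost)
  qed
qed

text \<open>The surviving walk cannot stay at bounded height because it visits each line finitely often
  in the mean, and it cannot be high because its height is a supermartingale.\<close>

lemma kill_pow_bounded_height_tendsto_0: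
  assumes K: "line 0 \<subseteq> K" and G: "\<And>z. 0 \<le> G z" "\<And>z. G z \<le> C" "\<And>z. G z \<le> C * ht_off K z" and C: "0 \<le> C"
  shows "(\<lambda>m. (kill K ^^ m) G y) \<longlonglongrightarrow> 0"
proof (rule LIMSEQ_I)
  fix r :: real assume r: "0 < r"
  obtain R :: nat where R: "2 * C * ht y < r * R" and R0: "0 < R"
  proof -
    obtain R :: nat where "2 * C * ht y / r < R" using reals_Archimedean2 by blast
    then have "2 * C * ht y < r * (Suc R)" using r by (simp add: field_simps)
    then show ?thesis using that by blast
  qed
  \<comment> \<open>Heights \<open>1, ..., R\<close> are covered by the line indicators and larger
    ones as in Markov's inequality. The choice of \<open>R\<close> makes the second part contribute
    at most \<open>r / 2\<close>.\<close>
  define F where "F z = C * (\<Sum>j\<in>{1..R}. line_off K j z) + C / R * ht_off K z" for z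
  have GF: "G z \<le> F z" for z
  proof (cases "z \<in> K \<or> snd z \<le> 0")
    case True
    then have "ht_off K z = 0" by (auto simp: ht_off_def ht_def)
    then have "G z \<le> 0" using G(3)[of z] by simp
    moreover have "0 \<le> C * (\<Sum>j\<in>{1..R}. line_off K j z)"
      using C by (intro mult_nonneg_nonneg sum_nonneg) (auto simp: line_off_def)
    ultimately show ?thesis using \<open>ht_off K z = 0\<close> by (simp add: F_def)
  next
    case False
    show ?thesis
    proof (cases "snd z \<le> int R")
      case True
      have "1 \<le> (\<Sum>j\<in>{1..R}. line_off K j z)"
      proof -
        have "line_off K (nat (snd z)) z \<le> (\<Sum>j\<in>{1..R}. line_off K j z)"
          using False True by (intro member_le_sum) (auto simp: line_off_def)
        then show ?thesis using False by (auto simp: line_off_def line_def)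
      qed
      then have "C \<le> C * (\<Sum>j\<in>{1..R}. line_off K j z)" using C by (simp add: mult_le_cancel_left1)
      moreover have "0 \<le> C / R * ht_off K z" using C by (intro mult_nonneg_nonneg ht_off_nonneg) auto
      ultimately show ?thesis using G(2)[of z] unfolding F_def by linarith
    next
      case high: False
      then have "R \<le> ht_off K z" using False by (simp add: ht_off_def ht_def)
      then have "C / R * R \<le> C / R * ht_off K z" using C by (intro mult_left_mono) auto
      then have "C \<le> C / R * ht_off K z" using R0 by simp
      moreover have "0 \<le> C * (\<Sum>j\<in>{1..R}. line_off K j z)"
        using C by (intro mult_nonneg_nonneg sum_nonneg) (auto simp: line_off_def)
      ultimately show ?thesis using G(2)[of z] unfolding F_def by linarith
    qed
  qed
  have "(\<lambda>m. C * (\<Sum>j\<in>{1..R}. (kill K ^^ m) (line_off K j) y)) \<longlonglongrightarrow> C * (\<Sum>j\<in>{1..R}. 0)"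
    by (intro tendsto_intros summable_LIMSEQ_zero kill_pow_line_off_summable K) auto
  then have "\<forall>\<^sub>F m in sequentially. C * (\<Sum>j\<in>{1..R}. (kill K ^^ m) (line_off K j) y) < r / 2"
    using r by (intro order_tendstoD) auto
  then obtain M where M: "\<And>m. M \<le> m \<Longrightarrow> C * (\<Sum>j\<in>{1..R}. (kill K ^^ m) (line_off K j) y) < r / 2"
    by (auto simp: eventually_sequentially)
  show "\<exists>no. \<forall>n\<ge>no. norm ((kill K ^^ n) G y - 0) < r"
  proof (intro exI allI impI)
    fix m assume "M \<le> m"
    have "(kill K ^^ m) G y \<le> (kill K ^^ m) F y" by (rule kill_pow_mono) (rule GF)
    also have "\<dots> = C * (\<Sum>j\<in>{1..R}. (kill K ^^ m) (line_off K j) y) + C / R * (kill K ^^ m) (ht_off K) y"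
      unfolding F_def kill_pow_linear kill_pow_sum ..
    also have "\<dots> < r / 2 + C / R * (kill K ^^ m) (ht_off K) y" using M[OF \<open>M \<le> m\<close>] by simp
    also have "C / R * (kill K ^^ m) (ht_off K) y \<le> C / R * ht y"
    proof (intro mult_left_mono)
      have "(kill K ^^ m) (ht_off K) y \<le> ht_off K y" using kill_pow_ht_off_le[OF K, of 0 m y] by simp
      also have "\<dots> \<le> ht y" by (simp add: ht_off_def)
      finally show "(kill K ^^ m) (ht_off K) y \<le> ht y" .
    qed (use C in simp)
    also have "C / R * ht y \<le> r / 2" using R R0 by (simp add: field_simps)
    finally show "norm ((kill K ^^ m) G y - 0) < r"
      using kill_pow_nonneg[of G m K y, OF G(1)] by simp
  qed
qed

text \<open>The excess \<open>D\<close> of the height over \<open>N\<close> is harmonic off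
  \<open>K\<close> except on \<open>line N\<close>, where its average exceeds it by a quarter. Line
  visits therefore telescope to the growth of the killed iterates of \<open>D\<close>. These
  converge to the escape potential because height and \<open>D\<close> differ by a bounded amount.
  The sum does not depend on \<open>N\<close>.\<close>

lemma line_visits_sums_escape:
  assumes K: "line 0 \<subseteq> K" and N: "0 < N" "\<And>z. z \<in> K \<Longrightarrow> snd z \<le> int N" "snd y \<le> int N"
  shows "(\<lambda>m. (kill K ^^ m) (line_off K N) y / 4) sums escape K y"
proof -
  define D where "D z = real_of_int (max 0 (snd z - int N))" for z :: point
  have D: "line_off K N z / 4 = kill K D z - D z" for z
  proof (cases "z \<in> K")
    case True
    then show ?thesis using N(2)[OF True] by (simp add: line_off_def kill_def D_def)
  next
    case False
    then show ?thesis
      by (cases z) (auto simp: line_off_def kill_def D_def avg_def line_def indicator_def max_def)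
  qed
  have step: "(kill K ^^ m) (line_off K N) y / 4 = (kill K ^^ Suc m) D y - (kill K ^^ m) D y" for m
  proof -
    have "(kill K ^^ m) (line_off K N) y = (kill K ^^ m) (\<lambda>z. 4 * kill K D z + (-4) * D z) y"
    proof (rule arg_cong[where f = "\<lambda>f. (kill K ^^ m) f y"], rule ext)
      show "line_off K N z = 4 * kill K D z + (-4) * D z" for z using D[of z] by simp
    qed
    then show ?thesis unfolding kill_pow_linear funpow_Suc_inner by simp
  qed
  have "(\<lambda>m. (kill K ^^ m) (\<lambda>z. ht_off K z - D z) y) \<longlonglongrightarrow> 0"
  proof (rule kill_pow_bounded_height_tendsto_0[OF K, where C = N])
    fix z
    show "0 \<le> ht_off K z - D z" using N(2)[of z] by (auto simp: ht_off_def ht_def D_def)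
    show "ht_off K z - D z \<le> real N" by (auto simp: ht_off_def ht_def D_def)
    have "ht_off K z - D z \<le> ht_off K z" by (simp add: D_def)
    also have "\<dots> \<le> N * ht_off K z" using N(1) ht_off_nonneg[of K z]
      by (simp add: mult_le_cancel_right1 Suc_le_eq)
    finally show "ht_off K z - D z \<le> N * ht_off K z" .
  qed auto
  from tendsto_diff[OF escape_tendsto[OF K, of y] this]
  have "(\<lambda>m. (kill K ^^ m) D y) \<longlonglongrightarrow> escape K y" by (simp add: kill_pow_diff)
  moreover have "D y = 0" using N(3) by (simp add: D_def)
  ultimately show ?thesis
    unfolding sums_def step by (subst sum_lessThan_telescope) simp
qed

section \<open>From the random walk to the escape potential\<close>

text \<open>As an integral, the sum over starting points can be exchanged with the sum over entrance
  times. The set \<open>A\<close> is exhausted by its finitely many elements of bounded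
  code.\<close>

lemma infsum_ennreal_eq_nn_integral:
  fixes f :: "'b::countable \<Rightarrow> ennreal"
  shows "infsum f A = (\<integral>\<^sup>+x. f x \<partial>count_space A)"
proof -
  have fin: "sum f F = (\<integral>\<^sup>+x. f x * indicator F x \<partial>count_space A)" if "finite F" "F \<subseteq> A" for F
    using that by (subst nn_integral_count_space'[of F]) auto
  have infsum: "infsum f A = (SUP F\<in>{F. finite F \<and> F \<subseteq> A}. sum f F)"
    by (rule nonneg_infsum_complete) simp
  define F where "F n = A \<inter> {x. to_nat x \<le> n}" for n
  have finF: "finite (F n)" for n
    unfolding F_def by (rule finite_subset[of _ "from_nat ` {..n}"]) (auto simp: image_iff intro: from_nat_to_nat[symmetric])
  have "(\<integral>\<^sup>+x. f x \<partial>count_space A) = (\<integral>\<^sup>+x. (SUP n. f x * indicator (F n) x) \<partial>count_space A)"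
  proof (intro nn_integral_cong antisym)
    fix x assume "x \<in> space (count_space A)"
    then have "f x = f x * indicator (F (to_nat x)) x" by (simp add: F_def)
    also have "\<dots> \<le> (SUP n. f x * indicator (F n) x)" by (rule SUP_upper) simp
    finally show "f x \<le> (SUP n. f x * indicator (F n) x)" .
    show "(SUP n. f x * indicator (F n) x) \<le> f x"
      by (intro SUP_least) (auto simp: indicator_def)
  qed
  also have "\<dots> = (SUP n. \<integral>\<^sup>+x. f x * indicator (F n) x \<partial>count_space A)"
    by (intro nn_integral_monotone_convergence_SUP)
       (auto simp: incseq_def le_fun_def F_def indicator_def)
  also have "\<dots> = (SUP n. sum f (F n))"
    using finF by (intro SUP_cong refl fin[symmetric]) (auto simp: F_def)
  also have "\<dots> \<le> infsum f A"
    unfolding infsum using finF by (intro SUP_least SUP_upper) (auto simp: F_def)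
  finally have "(\<integral>\<^sup>+x. f x \<partial>count_space A) \<le> infsum f A" .
  moreover have "infsum f A \<le> (\<integral>\<^sup>+x. f x \<partial>count_space A)"
    unfolding infsum
  proof (intro SUP_least)
    fix F assume F: "F \<in> {F. finite F \<and> F \<subseteq> A}"
    then have "sum f F = (\<integral>\<^sup>+x. f x * indicator F x \<partial>count_space A)" by (intro fin) auto
    also have "\<dots> \<le> (\<integral>\<^sup>+x. f x \<partial>count_space A)" by (intro nn_integral_mono) (auto simp: indicator_def)
    finally show "sum f F \<le> (\<integral>\<^sup>+x. f x \<partial>count_space A)" .
  qed
  ultimately show ?thesis by (rule antisym[rotated])
qed

section \<open>One-step analysis of the simple random walk\<close>

interpretation srw: sequence_space "measure_pmf srw_step"
  by standard

lemma srw_space_eq: "srw.S = srw_space"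
  by (simp add: srw_space_def)

lemma prob_space_srw: "prob_space srw_space"
  unfolding srw_space_def by (rule prob_space_PiM) (rule prob_space_measure_pmf)

lemma space_srw [simp]: "space srw_space = UNIV"
  by (simp add: srw_space_def space_PiM)

lemma srw_coordinate_measurable: "(\<lambda>\<xi>. \<xi> i) \<in> srw_space \<rightarrow>\<^sub>M count_space UNIV"
proof -
  have "(\<lambda>\<xi>. \<xi> i) \<in> srw_space \<rightarrow>\<^sub>M measure_pmf srw_step"
    unfolding srw_space_def by (rule measurable_component_singleton) simp
  then show ?thesis by (simp cong: measurable_cong_sets)
qed

lemma srw_measurable [measurable]: "(\<lambda>\<xi>. srw z \<xi> n) \<in> srw_space \<rightarrow>\<^sub>M count_space UNIV"
proof (induction n)
  case (Suc n)
  have "(\<lambda>\<xi>. (\<lambda>a \<xi>. a + \<xi> n) (srw z \<xi> n) \<xi>) \<in> srw_space \<rightarrow>\<^sub>M count_space UNIV"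
  proof (rule measurable_compose_countable[OF _ Suc])
    fix a :: point
    show "(\<lambda>\<xi>. a + \<xi> n) \<in> srw_space \<rightarrow>\<^sub>M count_space UNIV"
      by (rule measurable_compose[OF srw_coordinate_measurable]) simp
  qed
  then show ?case by (simp add: srw_def add.assoc)
qed (simp add: srw_def)

lemma srw_0: "srw z \<xi> 0 = z"
  by (simp add: srw_def)

lemma srw_shift: "srw z (case_nat s \<xi>) (Suc n) = srw (z + s) \<xi> n"
  unfolding srw_def by (subst sum.lessThan_Suc_shift) (simp add: add.assoc)

text \<open>Prepending an independent step leaves the product law invariant, so the event can be
  integrated over the first step alone.\<close>

lemma srw_first_step:
  assumes A: "{\<xi>. P \<xi>} \<in> sets srw_space"
  shows "measure srw_space {\<xi>. P \<xi>} =
    (measure srw_space {\<xi>. P (case_nat (1,0) \<xi>)} + measure srw_space {\<xi>. P (case_nat (-1,0) \<xi>)} +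
     measure srw_space {\<xi>. P (case_nat (0,1) \<xi>)} + measure srw_space {\<xi>. P (case_nat (0,-1) \<xi>)}) / 4"
proof -
  interpret prob_space srw_space by (rule prob_space_srw)
  have meas: "(\<lambda>(s, \<xi>). case_nat s \<xi>) \<in> measure_pmf srw_step \<Otimes>\<^sub>M srw_space \<rightarrow>\<^sub>M srw_space"
    unfolding srw_space_def by measurable
  have "emeasure srw_space {\<xi>. P \<xi>} =
      emeasure (distr (measure_pmf srw_step \<Otimes>\<^sub>M srw_space) srw_space (\<lambda>(s, \<xi>). case_nat s \<xi>)) {\<xi>. P \<xi>}"
    using srw.PiM_iter unfolding srw_space_eq by simp
  also have "\<dots> = emeasure (measure_pmf srw_step \<Otimes>\<^sub>M srw_space)
      ((\<lambda>(s, \<xi>). case_nat s \<xi>) -` {\<xi>. P \<xi>} \<inter> space (measure_pmf srw_step \<Otimes>\<^sub>M srw_space))"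
    by (rule emeasure_distr[OF meas A])
  also have "\<dots> = (\<integral>\<^sup>+s. emeasure srw_space (Pair s -` ((\<lambda>(s, \<xi>). case_nat s \<xi>) -` {\<xi>. P \<xi>} \<inter>
      space (measure_pmf srw_step \<Otimes>\<^sub>M srw_space))) \<partial>measure_pmf srw_step)"
    by (rule emeasure_pair_measure_alt[OF measurable_sets[OF meas A]])
  also have "\<dots> = (\<integral>\<^sup>+s. ennreal (measure srw_space {\<xi>. P (case_nat s \<xi>)}) \<partial>measure_pmf srw_step)"
    by (intro nn_integral_cong) (simp add: space_pair_measure vimage_def emeasure_eq_measure)
  also have "\<dots> = ennreal ((measure srw_space {\<xi>. P (case_nat (1,0) \<xi>)} + measure srw_space {\<xi>. P (case_nat (-1,0) \<xi>)} +
     measure srw_space {\<xi>. P (case_nat (0,1) \<xi>)} + measure srw_space {\<xi>. P (case_nat (0,-1) \<xi>)}) / 4)"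
    unfolding srw_step_def
    by (subst nn_integral_pmf_of_set)
       (simp_all add: ennreal_plus[symmetric] divide_ennreal[symmetric] add.assoc del: ennreal_plus)
  finally show ?thesis by (simp add: emeasure_eq_measure)
qed

definition last_step :: "point set \<Rightarrow> point \<Rightarrow> point \<Rightarrow> point \<Rightarrow> nat \<Rightarrow> (nat \<Rightarrow> point) \<Rightarrow> bool" where
  "last_step K z y x m \<xi> \<longleftrightarrow> (\<forall>i\<le>m. srw z \<xi> i \<notin> K) \<and> srw z \<xi> m = y \<and> srw z \<xi> (Suc m) = x"

lemma last_step_measurable: "{\<xi>. last_step K z y x m \<xi>} \<in> sets srw_space"
proof -
  have "Measurable.pred srw_space (\<lambda>\<xi>. last_step K z y x m \<xi>)"
    unfolding last_step_def by measurable
  then show ?thesis by (simp add: pred_def)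
qed

lemma last_step_shift:
  "last_step K z y x (Suc m) (case_nat s \<xi>) \<longleftrightarrow> z \<notin> K \<and> last_step K (z + s) y x m \<xi>"
proof -
  have "(\<forall>i\<le>Suc m. srw z (case_nat s \<xi>) i \<notin> K) \<longleftrightarrow> z \<notin> K \<and> (\<forall>i\<le>m. srw (z + s) \<xi> i \<notin> K)"
    by (auto simp: All_less_Suc2 less_Suc_eq_le[symmetric] srw_0 srw_shift)
  then show ?thesis by (auto simp: last_step_def srw_shift)
qed

lemma neighbors_cases:
  "neighbors x y \<Longrightarrow> x = y + (1,0) \<or> x = y + (-1,0) \<or> x = y + (0,1) \<or> x = y + (0,-1)"
  by (cases x; cases y) (auto simp: neighbors_def)

text \<open>First-step induction; the factor \<open>1 / 4\<close> is the final step from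
  \<open>y\<close> to \<open>x\<close>. Nothing else depends on \<open>x\<close>, so all edges
  ending at \<open>y\<close> carry the same weight.\<close>

lemma prob_last_step:
  assumes "y \<notin> K" "neighbors x y"
  shows "measure srw_space {\<xi>. last_step K z y x m \<xi>} = (kill K ^^ m) (indicator {y}) z / 4"
proof (induction m arbitrary: z)
  case 0
  interpret prob_space srw_space by (rule prob_space_srw)
  have ev: "{\<xi>. last_step K z y x 0 (case_nat s \<xi>)} = (if z = y \<and> y + s = x then UNIV else {})" for s
    using assms by (auto simp: last_step_def srw_0 srw_shift[of _ _ _ 0, simplified])
  have U: "measure srw_space UNIV = 1" using prob_space by simp
  show ?case
    unfolding srw_first_step[OF last_step_measurable] ev
    using neighbors_cases[OF assms(2)] U by (cases y) (auto simp: indicator_def)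
next
  case (Suc m)
  show ?case
  proof (cases "z \<in> K")
    case True
    then have "{\<xi>. last_step K z y x (Suc m) \<xi>} = {}" by (auto simp: last_step_def srw_0 intro!: exI[of _ 0])
    then show ?thesis using True by (simp add: kill_def)
  next
    case False
    then have "measure srw_space {\<xi>. last_step K z y x (Suc m) \<xi>} = avg (\<lambda>z. (kill K ^^ m) (indicator {y}) z / 4) z"
      unfolding srw_first_step[OF last_step_measurable] last_step_shift by (simp add: Suc.IH avg_def)
    then show ?thesis using False by (simp add: kill_pow_Suc avg_def del: funpow.simps(2))
  qed
qed

section \<open>Entrance through a given edge, summed over the starting level\<close>

lemma hitting_time_eq_iff: "hitting_time K S = enat n \<longleftrightarrow> S n \<in> K \<and> (\<forall>i<n. S i \<notin> K)"
proof
  assume h: "hitting_time K S = enat n"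
  have ne: "enat ` {n. S n \<in> K} \<noteq> {}"
  proof
    assume "enat ` {n. S n \<in> K} = {}"
    then have "hitting_time K S = \<infinity>" unfolding hitting_time_def by (simp add: Inf_enat_def)
    with h show False by simp
  qed
  then have "hitting_time K S \<in> enat ` {n. S n \<in> K}"
    unfolding hitting_time_def Inf_enat_def by (simp, metis LeastI all_not_in_conv image_iff)
  then have "S n \<in> K" using h by auto
  moreover have "S i \<notin> K" if "i < n" for i
  proof
    assume "S i \<in> K"
    then have "hitting_time K S \<le> enat i" unfolding hitting_time_def by (intro Inf_lower) auto
    with h that show False by simp
  qed
  ultimately show "S n \<in> K \<and> (\<forall>i<n. S i \<notin> K)" by blast
next
  assume "S n \<in> K \<and> (\<forall>i<n. S i \<notin> K)"
  then show "hitting_time K S = enat n"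
    unfolding hitting_time_def
    by (intro antisym Inf_lower Inf_greatest) (auto simp: linorder_not_less[symmetric])
qed

text \<open>The hitting time determines the entrance time, so the events for different
  \<open>m\<close> are disjoint.\<close>

lemma prob_entrance_eq_suminf:
  assumes "x \<in> B" "y \<notin> absorbing B" "neighbors x y"
  shows "ennreal (\<P>(\<xi> in srw_space. \<exists>m. hitting_time (absorbing B) (srw z \<xi>) = enat (Suc m) \<and>
            srw z \<xi> (Suc m) = x \<and> srw z \<xi> m = y))
    = (\<Sum>m. ennreal ((kill (absorbing B) ^^ m) (indicator {y}) z / 4))"
proof -
  interpret prob_space srw_space by (rule prob_space_srw)
  let ?E = "\<lambda>m. {\<xi>. last_step (absorbing B) z y x m \<xi>}"
  have eq: "{\<xi> \<in> space srw_space. \<exists>m. hitting_time (absorbing B) (srw z \<xi>) = enat (Suc m) \<and>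
            srw z \<xi> (Suc m) = x \<and> srw z \<xi> m = y} = (\<Union>m. ?E m)"
    using assms(1) by (auto simp: hitting_time_eq_iff last_step_def less_Suc_eq_le)
  have "disjoint_family ?E"
  unfolding disjoint_family_on_def
  proof (intro ballI impI, rule ccontr)
    fix m n :: nat assume mn: "m \<noteq> n" "?E m \<inter> ?E n \<noteq> {}"
    then obtain \<xi> where l: "last_step (absorbing B) z y x m \<xi>" "last_step (absorbing B) z y x n \<xi>" by auto
    have "hitting_time (absorbing B) (srw z \<xi>) = enat (Suc k)" if "last_step (absorbing B) z y x k \<xi>" for k
      using that assms(1) by (auto simp: hitting_time_eq_iff last_step_def less_Suc_eq_le)
    from this[OF l(1)] this[OF l(2)] mn(1) show False by simp
  qed
  then have "(\<Sum>m. emeasure srw_space (?E m)) = emeasure srw_space (\<Union>m. ?E m)"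
    by (intro suminf_emeasure) (auto simp: last_step_measurable)
  then show ?thesis
    unfolding eq by (simp add: emeasure_eq_measure prob_last_step[OF assms(2,3)])
qed

text \<open>Reversal moves the start from \<open>line N\<close> to \<open>y\<close>; what remains is
  the expected number of visits to \<open>line N\<close> from \<open>y\<close>, evaluated by
  \<open>line_visits_sums_escape\<close>.\<close>

lemma harmonic_edge_level_eq:
  assumes "x \<in> B" "y \<notin> B" "0 \<le> snd y" "neighbors x y" "0 < N" "\<And>b. b \<in> B \<Longrightarrow> snd b \<le> int N" "snd y \<le> int N"
  shows "harmonic_edge_level B N (x, y) = ennreal (escape (absorbing B) y)"
proof (cases "y \<in> absorbing B")
  case True
  have "{\<xi> \<in> space srw_space. \<exists>m. hitting_time (absorbing B) (srw z \<xi>) = enat (Suc m) \<and>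
            srw z \<xi> (Suc m) = x \<and> srw z \<xi> m = y} = {}" for z
    unfolding hitting_time_eq_iff using True by force
  then have "\<P>(\<xi> in srw_space. \<exists>m. hitting_time (absorbing B) (srw z \<xi>) = enat (Suc m) \<and>
            srw z \<xi> (Suc m) = x \<and> srw z \<xi> m = y) = 0" for z
    by (metis measure_empty)
  then show ?thesis using True by (simp only: harmonic_edge_level_def prod.case) (simp add: escape_on)
next
  case False
  let ?K = "absorbing B"
  have "harmonic_edge_level B N (x, y) =
      (\<integral>\<^sup>+z. (\<Sum>m. ennreal ((kill ?K ^^ m) (indicator {y}) z / 4)) \<partial>count_space (line N - B))"
    unfolding harmonic_edge_level_def
    using prob_entrance_eq_suminf[OF assms(1) False assms(4)]
    by (simp add: infsum_ennreal_eq_nn_integral)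
  also have "\<dots> = (\<Sum>m. \<integral>\<^sup>+z. ennreal ((kill ?K ^^ m) (indicator {y}) z / 4) \<partial>count_space (line N - B))"
    by (rule nn_integral_suminf) simp
  also have "\<dots> = (\<Sum>m. ennreal ((kill ?K ^^ m) (line_off ?K N) y / 4))"
  proof (intro suminf_cong)
    fix m
    have lK: "line N - B = line N - ?K" using assms(5) by (auto simp: line_def)
    have "(\<integral>\<^sup>+z. ennreal ((kill ?K ^^ m) (indicator {y}) z / 4) \<partial>count_space (line N - B)) =
        (\<integral>\<^sup>+z. ennreal (1/4) * ennreal (line_off ?K N z * (kill ?K ^^ m) (indicator {y}) z) \<partial>count_space UNIV)"
      unfolding lK line_off_def
      by (subst nn_integral_count_space_indicator)
         (auto intro!: nn_integral_cong simp: indicator_def kill_pow_nonneg ennreal_mult[symmetric])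
    also have "\<dots> = ennreal (1/4) * pairing (line_off ?K N) ((kill ?K ^^ m) (indicator {y}))"
      unfolding pairing_def by (rule nn_integral_cmult) simp
    also have "pairing (line_off ?K N) ((kill ?K ^^ m) (indicator {y})) = pairing ((kill ?K ^^ m) (line_off ?K N)) (indicator {y})"
      using False by (intro pairing_kill_pow) (auto simp: line_off_def indicator_def)
    also have "\<dots> = ennreal ((kill ?K ^^ m) (line_off ?K N) y)"
      by (intro pairing_point kill_pow_nonneg) (simp add: line_off_def)
    finally show "(\<integral>\<^sup>+z. ennreal ((kill ?K ^^ m) (indicator {y}) z / 4) \<partial>count_space (line N - B)) =
        ennreal ((kill ?K ^^ m) (line_off ?K N) y / 4)"
      by (simp add: ennreal_mult[symmetric] kill_pow_nonneg line_off_def)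
  qed
  also have "\<dots> = ennreal (escape ?K y)"
  proof (rule suminf_ennreal_eq)
    show "0 \<le> (kill ?K ^^ m) (line_off ?K N) y / 4" for m
      by (auto intro!: kill_pow_nonneg simp: line_off_def)
    show "(\<lambda>m. (kill ?K ^^ m) (line_off ?K N) y / 4) sums escape ?K y"
      by (rule line_visits_sums_escape) (use assms in \<open>auto simp: line_def\<close>)
  qed
  finally show ?thesis .
qed

lemma harmonic_edge_eq:
  assumes "finite B" "x \<in> B" "y \<notin> B" "0 \<le> snd y" "neighbors x y"
  shows "harmonic_edge B (x, y) = ennreal (escape (absorbing B) y)"
proof -
  \<comment> \<open>The added one makes every level from \<open>N0\<close> on positive, as
    \<open>harmonic_edge_level_eq\<close> requires. The sequence is constant from there, so its
    limit is immediate.\<close>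
  define N0 where "N0 = nat (Max (insert (snd y) (snd ` B))) + 1"
  have b: "snd b \<le> int N" if "b \<in> insert y B" "N0 \<le> N" for b N
  proof -
    have "snd b \<le> Max (insert (snd y) (snd ` B))" using assms(1) that(1) by (intro Max_ge) auto
    then show ?thesis using that(2) unfolding N0_def by linarith
  qed
  have "\<forall>\<^sub>F N in sequentially. harmonic_edge_level B N (x, y) = ennreal (escape (absorbing B) y)"
    unfolding eventually_sequentially
    by (intro exI[of _ N0] allI impI harmonic_edge_level_eq assms) (use b in \<open>auto simp: N0_def\<close>)
  then have "(\<lambda>N. harmonic_edge_level B N (x, y)) \<longlonglongrightarrow> ennreal (escape (absorbing B) y)"
    by (rule tendsto_eventually)
  then show ?thesis unfolding harmonic_edge_def by (rule limI)
qed

section \<open>Dirichlet energy\<close>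

text \<open>Each edge is assigned to its left or lower endpoint and counted when that endpoint lies
  in \<open>S\<close>. To count all edges at \<open>z\<close>, the set must therefore contain
  \<open>z - (1, 0)\<close> and \<open>z - (0, 1)\<close> too.\<close>

definition dirichlet :: "point set \<Rightarrow> (point \<Rightarrow> real) \<Rightarrow> (point \<Rightarrow> real) \<Rightarrow> real" where
  "dirichlet S f g = (\<Sum>z\<in>S. (f (z + (1, 0)) - f z) * (g (z + (1, 0)) - g z) +
                            (f (z + (0, 1)) - f z) * (g (z + (0, 1)) - g z))"

lemma dirichlet_nonneg: "0 \<le> dirichlet S f f"
  unfolding dirichlet_def by (intro sum_nonneg) simp

lemma dirichlet_add:
  "dirichlet S (\<lambda>z. f z + w z) (\<lambda>z. f z + w z) = dirichlet S f f + 2 * dirichlet S f w + dirichlet S w w"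
  unfolding dirichlet_def sum_distrib_left sum.distrib[symmetric]
  by (intro sum.cong) (auto simp: algebra_simps)

lemma sum_by_parts_direction:
  fixes e :: point
  assumes "finite S" "\<And>z. z \<notin> W \<Longrightarrow> w z = 0" "\<And>z. z \<in> W \<Longrightarrow> z \<in> S \<and> z - e \<in> S"
  shows "(\<Sum>z\<in>S. (f (z + e) - f z) * (w (z + e) - w z)) = (\<Sum>z\<in>W. w z * (2 * f z - f (z + e) - f (z - e) :: real))"
proof -
  have finW: "finite W" using assms(1,3) by (meson finite_subset subsetI)
  have "(\<Sum>z\<in>S. (f (z + e) - f z) * w (z + e)) = (\<Sum>z\<in>(\<lambda>z. z - e) ` W. (f (z + e) - f z) * w (z + e))"
  proof (intro sum.mono_neutral_right assms(1) ballI)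
    show "(\<lambda>z. z - e) ` W \<subseteq> S" using assms(3) by auto
    fix z assume "z \<in> S - (\<lambda>z. z - e) ` W"
    then have "z + e \<notin> W" by (metis DiffD2 add_diff_cancel_right' imageI)
    then show "(f (z + e) - f z) * w (z + e) = 0" using assms(2) by simp
  qed
  also have "\<dots> = (\<Sum>z\<in>W. (f z - f (z - e)) * w z)"
    by (subst sum.reindex) (auto simp: inj_on_def)
  finally have 1: "(\<Sum>z\<in>S. (f (z + e) - f z) * w (z + e)) = (\<Sum>z\<in>W. (f z - f (z - e)) * w z)" .
  have 2: "(\<Sum>z\<in>S. (f (z + e) - f z) * w z) = (\<Sum>z\<in>W. (f (z + e) - f z) * w z)"
    using assms by (intro sum.mono_neutral_right) auto
  have "(\<Sum>z\<in>S. (f (z + e) - f z) * (w (z + e) - w z)) =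
      (\<Sum>z\<in>S. (f (z + e) - f z) * w (z + e)) - (\<Sum>z\<in>S. (f (z + e) - f z) * w z)"
    by (simp add: sum_subtractf[symmetric] right_diff_distrib)
  also have "\<dots> = (\<Sum>z\<in>W. w z * (2 * f z - f (z + e) - f (z - e)))"
    unfolding 1 2 sum_subtractf[symmetric] by (intro sum.cong) (auto simp: algebra_simps)
  finally show ?thesis .
qed

text \<open>Summation by parts in both directions. No boundary terms arise because every edge
  touching the support of \<open>w\<close> is counted.\<close>

lemma dirichlet_green:
  assumes "finite S" "\<And>z. z \<notin> W \<Longrightarrow> w z = 0"
    "\<And>z. z \<in> W \<Longrightarrow> z \<in> S \<and> z - (1, 0) \<in> S \<and> z - (0, 1) \<in> S"
  shows "dirichlet S f w = 4 * (\<Sum>z\<in>W. w z * (f z - avg f z))"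
proof -
  have "dirichlet S f w = (\<Sum>z\<in>W. w z * (2 * f z - f (z + (1,0)) - f (z - (1,0)))) +
      (\<Sum>z\<in>W. w z * (2 * f z - f (z + (0,1)) - f (z - (0,1))))"
    unfolding dirichlet_def sum.distrib using assms
    by (subst (1 2) sum_by_parts_direction[where W = W]) auto
  also have "\<dots> = 4 * (\<Sum>z\<in>W. w z * (f z - avg f z))"
  proof -
    have m: "z + (- 1, 0) = z - (1, 0)" "z + (0, - 1) = z - (0, 1)" for z :: point
      by (cases z; simp)+
    show ?thesis
      unfolding sum_distrib_left sum.distrib[symmetric] avg_def m
      by (intro sum.cong) (auto simp: field_simps)
  qed
  finally show ?thesis .
qed

lemma dirichlet_pythagoras:
  assumes "finite S" "\<And>z. z \<notin> W \<Longrightarrow> w z = 0"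
    "\<And>z. z \<in> W \<Longrightarrow> z \<in> S \<and> z - (1, 0) \<in> S \<and> z - (0, 1) \<in> S"
    "\<And>z. z \<in> W \<Longrightarrow> avg f z = f z"
  shows "dirichlet S (\<lambda>z. f z + w z) (\<lambda>z. f z + w z) = dirichlet S f f + dirichlet S w w"
  unfolding dirichlet_add using dirichlet_green[OF assms(1-3), where f = f] assms(4) by simp

lemma dirichlet_ge_edge:
  assumes "finite S" "x \<in> S" "y \<in> S" "neighbors x y"
  shows "(f x - f y)\<^sup>2 \<le> dirichlet S f f"
proof -
  let ?t = "\<lambda>z. (f (z + (1, 0)) - f z) * (f (z + (1, 0)) - f z) + (f (z + (0, 1)) - f z) * (f (z + (0, 1)) - f z)"
  have t: "?t z \<le> dirichlet S f f" if "z \<in> S" for z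
    unfolding dirichlet_def by (rule member_le_sum) (use assms that in auto)
  have "(f x - f y)\<^sup>2 \<le> ?t x \<or> (f x - f y)\<^sup>2 \<le> ?t y"
  proof -
    have e: "(f (z + (1, 0)) - f z)\<^sup>2 \<le> ?t z" "(f (z + (0, 1)) - f z)\<^sup>2 \<le> ?t z" for z
      by (simp_all add: power2_eq_square)
    have m: "y + (- 1, 0) + (1, 0) = y" "y + (0, - 1) + (0, 1) = y" by (simp_all add: prod_eq_iff)
    show ?thesis
      using neighbors_cases[OF assms(4)] e[of y] e[of x]
      by (elim disjE) (simp_all only: m power2_commute[of "f y"], simp_all)
  qed
  then show ?thesis using t assms by (meson order_trans)
qed

section \<open>The Dirichlet problem in a box\<close>

definition box :: "point \<Rightarrow> int \<Rightarrow> point set" where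
  "box c r = {fst c - r..fst c + r} \<times> {snd c - r..snd c + r}"

lemma finite_box [simp]: "finite (box c r)"
  by (simp add: box_def)

lemma in_box_iff: "z \<in> box c r \<longleftrightarrow> \<bar>fst z - fst c\<bar> \<le> r \<and> \<bar>snd z - snd c\<bar> \<le> r"
  by (cases z) (auto simp: box_def)

lemma box_interior: "z \<in> box c r \<Longrightarrow> z \<in> box c (r + 1) \<and> z - (1, 0) \<in> box c (r + 1) \<and> z - (0, 1) \<in> box c (r + 1)"
  by (cases z) (auto simp: in_box_iff)

definition relax :: "point set \<Rightarrow> (point \<Rightarrow> real) \<Rightarrow> (point \<Rightarrow> real) \<Rightarrow> point \<Rightarrow> real" where
  "relax U g f z = (if z \<in> U then avg f z else g z)"

text \<open>Solution of the Dirichlet problem by iterated averaging. Started from a datum that is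
  superharmonic on \<open>U\<close>, the iterates decrease, which gives convergence without a
  compactness argument.\<close>

definition harmonic_ext :: "point set \<Rightarrow> (point \<Rightarrow> real) \<Rightarrow> point \<Rightarrow> real" where
  "harmonic_ext U g z = lim (\<lambda>m. (relax U g ^^ m) g z)"

context
  fixes U :: "point set" and g :: "point \<Rightarrow> real"
  assumes g_nonneg: "\<And>z. 0 \<le> g z" and g_super: "\<And>z. z \<in> U \<Longrightarrow> avg g z \<le> g z"
begin

lemma relax_pow_Suc: "(relax U g ^^ Suc m) g z = (if z \<in> U then avg ((relax U g ^^ m) g) z else g z)"
  by (simp add: relax_def)

lemma relax_pow_nonneg: "0 \<le> (relax U g ^^ m) g z"
  by (induction m arbitrary: z) (auto simp: g_nonneg relax_pow_Suc avg_nonneg simp del: funpow.simps(2))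

lemma relax_pow_Suc_le: "(relax U g ^^ Suc m) g z \<le> (relax U g ^^ m) g z"
proof (induction m arbitrary: z)
  case (Suc m)
  have "avg ((relax U g ^^ Suc m) g) z \<le> avg ((relax U g ^^ m) g) z" by (rule avg_mono) (rule Suc.IH)
  then show ?case unfolding relax_pow_Suc[of "Suc m" z] relax_pow_Suc[of m z] by (simp del: funpow.simps(2))
qed (simp add: relax_def g_super)

lemma relax_pow_antimono: "m \<le> n \<Longrightarrow> (relax U g ^^ n) g z \<le> (relax U g ^^ m) g z"
  by (rule lift_Suc_antimono_le[where f = "\<lambda>m. (relax U g ^^ m) g z"]) (rule relax_pow_Suc_le)

lemma harmonic_ext_tendsto: "(\<lambda>m. (relax U g ^^ m) g z) \<longlonglongrightarrow> harmonic_ext U g z"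
proof -
  have "monoseq (\<lambda>m. (relax U g ^^ m) g z)"
    using relax_pow_antimono by (intro decseq_imp_monoseq) (simp add: decseq_def)
  moreover have "Bseq (\<lambda>m. (relax U g ^^ m) g z)"
    using relax_pow_antimono[of 0] relax_pow_nonneg
    by (intro BseqI'[of _ "g z"]) (auto simp: abs_of_nonneg)
  ultimately have "convergent (\<lambda>m. (relax U g ^^ m) g z)"
    by (intro Bseq_monoseq_convergent)
  then show ?thesis unfolding harmonic_ext_def by (simp add: convergent_LIMSEQ_iff)
qed

lemma harmonic_ext_boundary: "z \<notin> U \<Longrightarrow> harmonic_ext U g z = g z"
proof -
  assume z: "z \<notin> U"
  have "(relax U g ^^ m) g z = g z" for m using z by (cases m) (auto simp: relax_def)
  then show ?thesis using harmonic_ext_tendsto[of z] by (simp add: LIMSEQ_const_iff)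
qed

lemma harmonic_ext_harmonic: "z \<in> U \<Longrightarrow> avg (harmonic_ext U g) z = harmonic_ext U g z"
proof -
  assume z: "z \<in> U"
  have "(\<lambda>m. (relax U g ^^ Suc m) g z) \<longlonglongrightarrow> harmonic_ext U g z"
    using harmonic_ext_tendsto by (rule LIMSEQ_Suc)
  moreover have "(\<lambda>m. (relax U g ^^ Suc m) g z) \<longlonglongrightarrow> avg (harmonic_ext U g) z"
    using z by (simp add: relax_pow_Suc avg_tendsto harmonic_ext_tendsto del: funpow.simps(2))
  ultimately show ?thesis by (rule LIMSEQ_unique[rotated])
qed

text \<open>The difference lives in \<open>U\<close>, where the extension is harmonic, so the two
  are orthogonal. The exact energy gap is kept because it supplies the gain per inserted
  point.\<close>

lemma harmonic_ext_minimal: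
  assumes "finite S" "\<And>z. z \<in> U \<Longrightarrow> z \<in> S \<and> z - (1, 0) \<in> S \<and> z - (0, 1) \<in> S"
    "\<And>z. z \<notin> U \<Longrightarrow> t z = g z"
  shows "dirichlet S t t = dirichlet S (harmonic_ext U g) (harmonic_ext U g) +
     dirichlet S (\<lambda>z. t z - harmonic_ext U g z) (\<lambda>z. t z - harmonic_ext U g z)"
  using dirichlet_pythagoras[of S U "\<lambda>z. t z - harmonic_ext U g z" "harmonic_ext U g"] assms
  by (simp add: harmonic_ext_boundary harmonic_ext_harmonic)

end

definition free_box :: "point \<Rightarrow> int \<Rightarrow> point set \<Rightarrow> point set" where
  "free_box c r D = box c r - absorbing D"

definition box_potential :: "point \<Rightarrow> int \<Rightarrow> point set \<Rightarrow> point \<Rightarrow> real" where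
  "box_potential c r D = harmonic_ext (free_box c r D) (ht_off D)"

lemma ht_off_super: "z \<in> free_box c r D \<Longrightarrow> avg (ht_off D) z \<le> ht_off D z"
proof -
  assume z: "z \<in> free_box c r D"
  then have "snd z \<noteq> 0" "z \<notin> D" by (auto simp: free_box_def line_def)
  then have "avg ht z = ht_off D z" by (simp add: avg_ht ht_off_def)
  moreover have "avg (ht_off D) z \<le> avg ht z" by (rule avg_mono) (simp add: ht_off_def)
  ultimately show ?thesis by simp
qed

lemma box_potential_tendsto:
  "(\<lambda>m. (relax (free_box c r D) (ht_off D) ^^ m) (ht_off D) z) \<longlonglongrightarrow> box_potential c r D z"
  unfolding box_potential_def by (rule harmonic_ext_tendsto) (auto intro: ht_off_nonneg ht_off_super)

lemma box_potential_boundary: "z \<notin> free_box c r D \<Longrightarrow> box_potential c r D z = ht_off D z"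
  unfolding box_potential_def by (rule harmonic_ext_boundary) (auto intro: ht_off_nonneg ht_off_super)

lemma box_potential_minimal:
  assumes "\<And>z. z \<notin> free_box c r D \<Longrightarrow> t z = ht_off D z"
  shows "dirichlet (box c (r + 1)) t t =
     dirichlet (box c (r + 1)) (box_potential c r D) (box_potential c r D) +
     dirichlet (box c (r + 1)) (\<lambda>z. t z - box_potential c r D z) (\<lambda>z. t z - box_potential c r D z)"
  unfolding box_potential_def
  by (rule harmonic_ext_minimal[where U = "free_box c r D"])
     (use assms in \<open>auto intro: ht_off_nonneg ht_off_super simp: free_box_def dest: box_interior\<close>)

lemma ht_line_0: "z \<in> line 0 \<Longrightarrow> ht z = 0"
  by (simp add: line_def ht_def)

text \<open>The iterates are compared: in the free box both are averaged, and elsewhere the killed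
  iterate stays below its initial value, hence below the boundary datum.\<close>

lemma escape_le_box_potential: "escape (absorbing D) z \<le> box_potential c r D z"
proof -
  have "(kill (absorbing D) ^^ m) (ht_off (absorbing D)) z \<le> (relax (free_box c r D) (ht_off D) ^^ m) (ht_off D) z" for m
  proof (induction m arbitrary: z)
    case 0
    show ?case by (simp add: ht_off_def)
  next
    case (Suc m)
    show ?case
    proof (cases "z \<in> free_box c r D")
      case True
      then have "z \<notin> absorbing D" by (auto simp: free_box_def)
      then show ?thesis using True avg_mono[OF Suc.IH]
        by (simp add: kill_pow_Suc relax_pow_Suc[where U = "free_box c r D" and g = "ht_off D", OF ht_off_nonneg ht_off_super] del: funpow.simps(2))
    next
      case False
      have "(kill (absorbing D) ^^ Suc m) (ht_off (absorbing D)) z \<le> ht_off (absorbing D) z"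
        using kill_pow_ht_off_le[of "absorbing D" 0 "Suc m" z] by simp
      also have "\<dots> \<le> ht_off D z" by (simp add: ht_off_def)
      also have "\<dots> = (relax (free_box c r D) (ht_off D) ^^ Suc m) (ht_off D) z"
        using False by (simp add: relax_def)
      finally show ?thesis .
    qed
  qed
  then show ?thesis
    by (intro LIMSEQ_le[OF escape_tendsto[of "absorbing D"] box_potential_tendsto[of c r D]]) auto
qed

text \<open>Both potentials vanish at \<open>x\<close> and the new one also at \<open>y\<close>.
  Across this edge their difference jumps by the old potential at \<open>y\<close>, which dominates
  the escape potential, and the squared jump is part of the energy gap.\<close>

lemma box_potential_insert:
  assumes x: "x \<in> D" and xy: "neighbors x y" and box: "x \<in> box c r" "y \<in> box c r"
  shows "dirichlet (box c (r + 1)) (box_potential c r D) (box_potential c r D) + (escape (absorbing D) y)\<^sup>2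
    \<le> dirichlet (box c (r + 1)) (box_potential c r (insert y D)) (box_potential c r (insert y D))"
proof (cases "y \<in> absorbing D")
  case True
  then have "ht_off (insert y D) = ht_off D" "free_box c r (insert y D) = free_box c r D"
    by (auto simp: ht_off_def fun_eq_iff free_box_def ht_line_0)
  moreover have "escape (absorbing D) y = 0" using True by (intro escape_on) auto
  ultimately show ?thesis by (simp add: box_potential_def)
next
  case False
  let ?S = "box c (r + 1)" and ?u = "box_potential c r D" and ?u' = "box_potential c r (insert y D)"
  let ?w = "\<lambda>z. ?u' z - ?u z"
  have "?u' z = ht_off D z" if "z \<notin> free_box c r D" for z
  proof -
    have "z \<noteq> y" using that False box by (auto simp: free_box_def)
    moreover have "z \<notin> free_box c r (insert y D)" using that by (auto simp: free_box_def)
    ultimately show ?thesis by (simp add: box_potential_boundary ht_off_def)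
  qed
  then have "dirichlet ?S ?u' ?u' = dirichlet ?S ?u ?u + dirichlet ?S ?w ?w"
    by (rule box_potential_minimal)
  moreover have "(?w x - ?w y)\<^sup>2 \<le> dirichlet ?S ?w ?w"
    by (rule dirichlet_ge_edge) (use xy box in \<open>auto dest: box_interior\<close>)
  moreover have "?u x = 0" "?u' x = 0" "?u' y = 0"
    using x by (auto simp: box_potential_boundary free_box_def ht_off_def)
  moreover have "(escape (absorbing D) y)\<^sup>2 \<le> (?u y)\<^sup>2"
    by (intro power_mono escape_le_box_potential escape_nonneg) auto
  ultimately show ?thesis by simp
qed

section \<open>Escape potentials along a path\<close>

text \<open>The head is the newest point, and the obstacle for each point consists of the older
  points behind it. The oldest point has no entry, so the result is one shorter than a nonempty
  path.\<close>

fun path_escapes :: "point list \<Rightarrow> real list" where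
  "path_escapes (x # x' # xs) = escape (absorbing (set (x' # xs))) x # path_escapes (x' # xs)"
| "path_escapes _ = []"

lemma neighbors_sym: "neighbors x y \<Longrightarrow> neighbors y x"
  by (auto simp: neighbors_def)

lemma path_escapes_energy:
  assumes "xs \<noteq> []" "successively neighbors xs" "set xs \<subseteq> box c r"
  shows "sum_list (map (\<lambda>v. v\<^sup>2) (path_escapes xs)) \<le>
    dirichlet (box c (r + 1)) (box_potential c r (set xs)) (box_potential c r (set xs))"
  using assms
proof (induction xs rule: path_escapes.induct)
  case (1 x x' xs)
  have "(escape (absorbing (set (x' # xs))) x)\<^sup>2 + sum_list (map (\<lambda>v. v\<^sup>2) (path_escapes (x' # xs)))
     \<le> (escape (absorbing (set (x' # xs))) x)\<^sup>2 +
      dirichlet (box c (r + 1)) (box_potential c r (set (x' # xs))) (box_potential c r (set (x' # xs)))"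
    using 1 by simp
  also have "\<dots> \<le> dirichlet (box c (r + 1)) (box_potential c r (insert x (set (x' # xs))))
      (box_potential c r (insert x (set (x' # xs))))"
    using box_potential_insert[of x' "set (x' # xs)" x c r] 1 by (auto dest: neighbors_sym)
  finally show ?case by simp
qed (simp_all add: dirichlet_nonneg)

lemma path_in_box:
  assumes "xs \<noteq> []" "successively neighbors xs"
  shows "set xs \<subseteq> box (hd xs) (int (length xs) - 1)"
  using assms
proof (induction xs rule: path_escapes.induct)
  case (1 x x' xs)
  have nb: "neighbors x x'" using 1 by simp
  have IH: "set (x' # xs) \<subseteq> box x' (int (length (x' # xs)) - 1)" using 1 by simp
  have "z \<in> box x (int (length (x # x' # xs)) - 1)" if "z \<in> set (x' # xs)" for z
  proof -
    have "z \<in> box x' (int (length (x' # xs)) - 1)" using IH that by blast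
    then show ?thesis using nb unfolding in_box_iff neighbors_def by auto
  qed
  moreover have "x \<in> box x (int (length (x # x' # xs)) - 1)" by (simp add: in_box_iff)
  ultimately show ?case by auto
qed (auto simp: in_box_iff)

text \<open>The trial function vanishes on the box of radius \<open>h\<close> around the tip and agrees with the height
  outside the box of radius \<open>2 h\<close>.\<close>

lemma box_potential_energy_le:
  assumes c: "snd c = 2 * int h" and h: "0 < h" and D: "D \<subseteq> box c (int h)"
  shows "dirichlet (box c (2 * int h + 1)) (box_potential c (2 * int h) D) (box_potential c (2 * int h) D)
    \<le> 1568 * real h ^ 2"
proof -
  let ?S = "box c (2 * int h + 1)" and ?u = "box_potential c (2 * int h) D"
  define d where "d z = max \<bar>fst z - fst c\<bar> \<bar>snd z - snd c\<bar>" for z :: point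
  \<comment> \<open>The slope \<open>4\<close> makes \<open>t\<close> equal to the height outside
    the box of radius \<open>2 h\<close>: there the height is at most \<open>2 h + d z\<close>,
    which is at most \<open>4 (d z - h)\<close> once \<open>d z\<close> is at least
    \<open>2 h\<close>.\<close>
  define t where "t z = real_of_int (min (max 0 (snd z)) (4 * max 0 (d z - int h)))" for z :: point
  have t_eq: "t z = ht_off D z" if "z \<notin> free_box c (2 * int h) D" for z
  proof (cases "z \<in> D")
    case True
    then have "d z \<le> int h" using D by (auto simp: d_def in_box_iff)
    then show ?thesis using True by (simp add: t_def ht_off_def)
  next
    case False
    show ?thesis
    proof (cases "z \<in> line 0")
      case True
      then show ?thesis by (simp add: t_def ht_off_def ht_def line_def)
    next
      case 2: False
      then have "z \<notin> box c (2 * int h)" using that False by (auto simp: free_box_def)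
      then have "2 * int h < d z" by (auto simp: d_def in_box_iff)
      moreover have "snd z \<le> 2 * int h + d z" using c by (auto simp: d_def)
      ultimately have "max 0 (snd z) \<le> 4 * max 0 (d z - int h)" by auto
      then show ?thesis using False by (simp add: t_def ht_off_def ht_def min_absorb1)
    qed
  qed
  have lip: "\<bar>t (z + e) - t z\<bar> \<le> 4" if "e = (1, 0) \<or> e = (0, 1)" for z e
  proof -
    have "\<bar>d (z + e) - d z\<bar> \<le> 1" "\<bar>snd (z + e) - snd z\<bar> \<le> 1" using that by (auto simp: d_def max_def)
    then have "\<bar>min (max 0 (snd (z + e))) (4 * max 0 (d (z + e) - int h)) -
        min (max 0 (snd z)) (4 * max 0 (d z - int h))\<bar> \<le> 4" by (auto simp: min_def max_def)
    then have "\<bar>real_of_int (min (max 0 (snd (z + e))) (4 * max 0 (d (z + e) - int h)) -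
        min (max 0 (snd z)) (4 * max 0 (d z - int h)))\<bar> \<le> real_of_int 4"
      by (subst of_int_abs[symmetric]) (simp only: of_int_le_iff)
    then show ?thesis unfolding t_def by simp
  qed
  have sq: "(t (z + e) - t z) * (t (z + e) - t z) \<le> 16" if "e = (1, 0) \<or> e = (0, 1)" for z e
    using abs_le_square_iff[of "t (z + e) - t z" 4] lip[OF that, of z] by (simp add: power2_eq_square)
  have "dirichlet ?S t t = dirichlet ?S ?u ?u + dirichlet ?S (\<lambda>z. t z - ?u z) (\<lambda>z. t z - ?u z)"
    by (rule box_potential_minimal) (rule t_eq)
  then have "dirichlet ?S ?u ?u \<le> dirichlet ?S t t" using dirichlet_nonneg by simp
  \<comment> \<open>Two squared increments of at most \<open>16\<close> per point, on a box of side
    \<open>4 h + 3\<close>, which is at most \<open>7 h\<close>. This gives the constant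
    \<open>32 * 49 = 1568\<close>.\<close>
  also have "\<dots> \<le> (\<Sum>z\<in>?S. 16 + 16)"
    unfolding dirichlet_def by (intro sum_mono add_mono sq) auto
  also have "\<dots> = 32 * real (card ?S)" by simp
  also have "card ?S = (4 * h + 3) ^ 2"
    by (simp add: box_def card_cartesian_product power2_eq_square nat_add_distrib nat_mult_distrib add.commute)
  also have "32 * real ((4 * h + 3) ^ 2) \<le> 32 * (7 * real h) ^ 2"
  proof -
    have "real (4 * h + 3) \<le> 7 * real h" using h by linarith
    then have "real (4 * h + 3) ^ 2 \<le> (7 * real h) ^ 2" by (rule power_mono) simp
    then show ?thesis by (simp only: of_nat_power mult_le_cancel_left_pos)
  qed
  finally show ?thesis by (simp add: power_mult_distrib)
qed

lemma path_escapes_square_sum: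
  assumes "successively neighbors xs" "length xs = Suc h" "snd (hd xs) = 2 * int h" "0 < h"
  shows "sum_list (map (\<lambda>v. v\<^sup>2) (path_escapes xs)) \<le> 1568 * real h ^ 2"
proof -
  have ne: "xs \<noteq> []" using assms(2) by auto
  have box: "set xs \<subseteq> box (hd xs) (int h)" using path_in_box[OF ne assms(1)] assms(2) by simp
  then have "set xs \<subseteq> box (hd xs) (2 * int h)" by (auto simp: in_box_iff)
  from path_escapes_energy[OF ne assms(1) this] box_potential_energy_le[OF assms(3,4) box]
  show ?thesis by simp
qed

section \<open>The energy needed to lift one point\<close>

text \<open>The mean of a row with \<open>k + 1\<close> entries is moved to the next row with
  \<open>k + 2\<close> entries by vertical increments, plus a correction for the extra last entry
  that horizontal increments control. Cauchy-Schwarz over the \<open>k + 1\<close> columns gives the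
  rate \<open>1 / (k + 1)\<close>; the \<open>2\<close> comes from squaring a sum of two
  terms.\<close>

lemma row_mean_step:
  fixes r r' :: "nat \<Rightarrow> real"
  shows "((\<Sum>i\<le>k. r i) / (real k + 1) - (\<Sum>i\<le>Suc k. r' i) / (real k + 2))\<^sup>2
    \<le> 2 / (real k + 1) * (\<Sum>i\<le>k. (r' (Suc i) - r' i)\<^sup>2 + (r i - r' i)\<^sup>2)"
proof -
  define a where "a i = \<bar>r i - r' i\<bar>" for i
  define b where "b i = \<bar>r' (Suc i) - r' i\<bar>" for i
  have dev: "\<bar>r' i - r' (Suc k)\<bar> \<le> sum b {..k}" if "i \<le> k" for i
  proof -
    have "r' (Suc k) - r' i = (\<Sum>j\<in>{i..<Suc k}. r' (Suc j) - r' j)"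
      using that by (subst sum_Suc_diff') auto
    then have "\<bar>r' i - r' (Suc k)\<bar> \<le> sum b {i..<Suc k}"
      unfolding b_def by (metis abs_minus_commute sum_abs)
    also have "\<dots> \<le> sum b {..k}" by (rule sum_mono2) (auto simp: b_def)
    finally show ?thesis .
  qed
  have "(\<Sum>i\<le>k. r i) / (real k + 1) - (\<Sum>i\<le>Suc k. r' i) / (real k + 2) =
      (\<Sum>i\<le>k. r i - r' i) / (real k + 1) + (\<Sum>i\<le>k. r' i - r' (Suc k)) / ((real k + 1) * (real k + 2))"
  proof -
    have "S / x - (T + c) / (x + 1) = (S - T) / x + (T - x * c) / (x * (x + 1))" if "0 < x" for S T c x :: real
      using that by (simp add: divide_simps) (simp add: algebra_simps)
    from this[of "real k + 1" "\<Sum>i\<le>k. r i" "\<Sum>i\<le>k. r' i" "r' (Suc k)"]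
    show ?thesis by (simp add: sum_subtractf add.commute add.left_commute)
  qed
  also have "\<bar>\<dots>\<bar> \<le> \<bar>\<Sum>i\<le>k. r i - r' i\<bar> / (real k + 1) + \<bar>\<Sum>i\<le>k. r' i - r' (Suc k)\<bar> / ((real k + 1) * (real k + 2))"
    by (rule order_trans[OF abs_triangle_ineq]) (simp add: abs_mult)
  also have "\<dots> \<le> sum a {..k} / (real k + 1) + (\<Sum>i\<le>k. sum b {..k}) / ((real k + 1) * (real k + 2))"
    unfolding a_def by (intro add_mono divide_right_mono sum_abs order_trans[OF sum_abs] sum_mono dev) auto
  also have "\<dots> = sum a {..k} / (real k + 1) + sum b {..k} / (real k + 2)"
  proof -
    have "(x * c) / (x * d) = c / d" if "0 < x" for x c d :: real using that by simp
    from this[of "real k + 1" "sum b {..k}" "real k + 2"] show ?thesis by (simp add: add.commute)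
  qed
  also have "\<dots> \<le> sum a {..k} / (real k + 1) + sum b {..k} / (real k + 1)"
    by (intro add_mono divide_left_mono) (auto intro!: sum_nonneg simp: a_def b_def)
  also have "\<dots> = (\<Sum>i\<le>k. a i + b i) / (real k + 1)"
    by (simp add: sum.distrib add_divide_distrib)
  finally have "\<bar>(\<Sum>i\<le>k. r i) / (real k + 1) - (\<Sum>i\<le>Suc k. r' i) / (real k + 2)\<bar>\<^sup>2 \<le> ((\<Sum>i\<le>k. a i + b i) / (real k + 1))\<^sup>2"
    by (intro power_mono) auto
  then have "((\<Sum>i\<le>k. r i) / (real k + 1) - (\<Sum>i\<le>Suc k. r' i) / (real k + 2))\<^sup>2 \<le> ((\<Sum>i\<le>k. a i + b i) / (real k + 1))\<^sup>2"
    by (simp only: power2_abs)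
  also have "\<dots> = (\<Sum>i\<le>k. a i + b i)\<^sup>2 / (real k + 1)\<^sup>2" by (simp add: power_divide)
  also have "\<dots> \<le> ((\<Sum>i\<le>k. (a i + b i)\<^sup>2) * (real k + 1)) / (real k + 1)\<^sup>2"
    using sum_squared_le_sum_of_squares[of "\<lambda>i. a i + b i" "{..k}"]
    by (intro divide_right_mono) (auto simp: add.commute)
  also have "\<dots> = (\<Sum>i\<le>k. (a i + b i)\<^sup>2) / (real k + 1)"
    by (simp add: power2_eq_square)
  also have "\<dots> \<le> (\<Sum>i\<le>k. 2 * ((r' (Suc i) - r' i)\<^sup>2 + (r i - r' i)\<^sup>2)) / (real k + 1)"
  proof (intro divide_right_mono sum_mono)
    fix i
    have "(a i + b i)\<^sup>2 \<le> 2 * ((b i)\<^sup>2 + (a i)\<^sup>2)"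
      using sum_squares_bound[of "a i" "b i"] by (simp add: power2_sum)
    then show "(a i + b i)\<^sup>2 \<le> 2 * ((r' (Suc i) - r' i)\<^sup>2 + (r i - r' i)\<^sup>2)" by (simp add: a_def b_def)
  qed simp
  also have "\<dots> = 2 / (real k + 1) * (\<Sum>i\<le>k. (r' (Suc i) - r' i)\<^sup>2 + (r i - r' i)\<^sup>2)"
    unfolding sum_distrib_left[symmetric] by simp
  finally show ?thesis .
qed

text \<open>The value at the apex is compared with the mean over successive rows of a triangle below it,
  which is the potential drop along a flow that spreads uniformly over the rows.\<close>

lemma point_energy_lower_bound:
  fixes f :: "point \<Rightarrow> real"
  assumes S: "finite S" and f0: "\<And>z. snd z = 0 \<Longrightarrow> f z = 0" and b: "snd b = int h"
    and tri: "\<And>i k. i \<le> k \<Longrightarrow> k < h \<Longrightarrow> (fst b + int i, int h - 1 - int k) \<in> S"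
  shows "(f b)\<^sup>2 \<le> 2 * (\<Sum>k<h. 1 / (real k + 1)) * dirichlet S f f"
proof -
  define r where "r k i = f (fst b + int i, int h - int k)" for k i
  define m where "m k = (\<Sum>i\<le>k. r k i) / (real k + 1)" for k
  define e where "e k = (\<Sum>i\<le>k. (r (Suc k) (Suc i) - r (Suc k) i)\<^sup>2 + (r k i - r (Suc k) i)\<^sup>2)" for k
  let ?loc = "\<lambda>z. (f (z + (1, 0)) - f z) * (f (z + (1, 0)) - f z) + (f (z + (0, 1)) - f z) * (f (z + (0, 1)) - f z)"
  have e0: "0 \<le> e k" for k unfolding e_def by (intro sum_nonneg) simp
  have step: "\<bar>m k - m (Suc k)\<bar> \<le> sqrt (2 / (real k + 1)) * sqrt (e k)" for k
  proof -
    have "(m k - m (Suc k))\<^sup>2 \<le> 2 / (real k + 1) * e k"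
      using row_mean_step[of "r k" k "r (Suc k)"] by (simp add: m_def e_def add.commute)
    then show ?thesis unfolding real_sqrt_mult[symmetric] by (rule real_le_rsqrt[of "\<bar>_\<bar>", simplified])
  qed
  have "f b = m 0" using b by (cases b) (simp add: m_def r_def)
  moreover have "m h = 0" unfolding m_def r_def by (simp add: f0)
  ultimately have "f b = (\<Sum>k<h. m k - m (Suc k))" by (simp add: sum_lessThan_telescope')
  then have "\<bar>f b\<bar> \<le> (\<Sum>k<h. \<bar>m k - m (Suc k)\<bar>)" by (simp add: sum_abs)
  also have "\<dots> \<le> (\<Sum>k<h. sqrt (2 / (real k + 1)) * sqrt (e k))" by (intro sum_mono step)
  finally have "\<bar>f b\<bar>\<^sup>2 \<le> (\<Sum>k<h. sqrt (2 / (real k + 1)) * sqrt (e k))\<^sup>2" by (intro power_mono) auto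
  also have "\<dots> \<le> (\<Sum>k<h. (sqrt (2 / (real k + 1)))\<^sup>2) * (\<Sum>k<h. (sqrt (e k))\<^sup>2)"
    by (rule Cauchy_Schwarz_ineq_sum)
  also have "\<dots> = 2 * (\<Sum>k<h. 1 / (real k + 1)) * (\<Sum>k<h. e k)"
    using e0 by (simp add: sum_distrib_left)
  also have "(\<Sum>k<h. e k) \<le> dirichlet S f f"
  proof -
    \<comment> \<open>Each vertex of the rows below the apex that is indexed here carries its right
      and its upward edge. The indexing is injective, so every edge is used at most once.\<close>
    let ?p = "\<lambda>(k, i). (fst b + int i, int h - 1 - int k)"
    have "(\<Sum>k<h. e k) = (\<Sum>k<h. \<Sum>i\<le>k. ?loc (?p (k, i)))"
      unfolding e_def r_def by (intro sum.cong refl) (simp add: power2_eq_square algebra_simps)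
    also have "\<dots> = (\<Sum>q\<in>(SIGMA k:{..<h}. {..k}). ?loc (?p q))"
      by (subst sum.Sigma) (auto simp: split_beta)
    also have "\<dots> = (\<Sum>z\<in>?p ` (SIGMA k:{..<h}. {..k}). ?loc z)"
      by (subst sum.reindex) (auto simp: inj_on_def)
    also have "\<dots> \<le> dirichlet S f f"
      unfolding dirichlet_def using S tri by (intro sum_mono2) auto
    finally show ?thesis .
  qed
  finally show ?thesis by (simp add: mult_left_mono sum_nonneg)
qed

lemma harmonic_sum_le: "0 < h \<Longrightarrow> (\<Sum>k<h. 1 / (real k + 1)) \<le> 1 + ln (real h)"
proof (induction h rule: nat_induct_non_zero)
  case (Suc h)
  have "ln (real h / real (Suc h)) \<le> real h / real (Suc h) - 1"
    using Suc.hyps by (intro ln_le_minus_one) auto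
  moreover have "ln (real h / real (Suc h)) = ln (real h) - ln (real (Suc h))"
    using Suc.hyps by (simp add: ln_div)
  moreover have "real h / real (Suc h) - 1 = - (1 / (real h + 1))" by (simp add: field_simps)
  ultimately show ?case using Suc.IH by simp
qed simp

section \<open>The total harmonic measure\<close>

text \<open>\<open>4 * avg\<close> sums over the four neighbours. For clusters in the half-plane
  this is the total harmonic measure, by \<open>harmonic_total_eq\<close>.\<close>

definition flux :: "point set \<Rightarrow> real" where
  "flux B = (\<Sum>x\<in>B. 4 * avg (escape (absorbing B)) x)"

lemma neighbor_set: "{y. neighbors x y} = {x + (1,0), x + (-1,0), x + (0,1), x + (0,-1)}"
  by (cases x) (auto simp: neighbors_def)

lemma sum_neighbors: "(\<Sum>y | neighbors x y. f y) = 4 * avg f x"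
  unfolding neighbor_set avg_def by (cases x) simp

lemma finite_outer_boundary: "finite B \<Longrightarrow> finite (outer_boundary B)"
proof (rule finite_subset[of _ "\<Union>x\<in>B. {y. neighbors x y}"])
  show "finite B \<Longrightarrow> finite (\<Union>x\<in>B. {y. neighbors x y})" by (simp add: neighbor_set)
qed (auto simp: outer_boundary_def)

lemma harmonic_point_eq:
  assumes "finite B" "y \<in> outer_boundary B"
  shows "harmonic_point B y = ennreal (\<Sum>x\<in>{x \<in> B. neighbors x y}. escape (absorbing B) y)"
proof -
  have "harmonic_point B y = (\<Sum>x\<in>{x \<in> B. neighbors x y}. ennreal (escape (absorbing B) y))"
    unfolding harmonic_point_def if_P[OF assms(2)]
    by (intro sum.cong refl harmonic_edge_eq) (use assms in \<open>auto simp: outer_boundary_def half_plane_def\<close>)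
  also have "\<dots> = ennreal (\<Sum>x\<in>{x \<in> B. neighbors x y}. escape (absorbing B) y)"
    by (rule sum_ennreal) (simp add: escape_nonneg)
  finally show ?thesis .
qed

text \<open>After exchanging the sums, the neighbours outside \<open>outer_boundary B\<close> can be
  added freely: they lie in \<open>B\<close> or below the half-plane, where the escape potential
  vanishes.\<close>

lemma harmonic_total_eq:
  assumes "finite B" "B \<subseteq> half_plane"
  shows "harmonic_total B = ennreal (flux B)"
proof -
  let ?V = "escape (absorbing B)"
  have "harmonic_total B = (\<Sum>y\<in>outer_boundary B. ennreal (\<Sum>x\<in>{x \<in> B. neighbors x y}. ?V y))"
    unfolding harmonic_total_def using assms by (simp add: harmonic_point_eq)
  also have "\<dots> = ennreal (\<Sum>y\<in>outer_boundary B. \<Sum>x\<in>{x \<in> B. neighbors x y}. ?V y)"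
    by (simp add: sum_ennreal sum_nonneg escape_nonneg)
  also have "(\<Sum>y\<in>outer_boundary B. \<Sum>x\<in>{x \<in> B. neighbors x y}. ?V y) =
      (\<Sum>x\<in>B. \<Sum>y\<in>{y \<in> outer_boundary B. neighbors x y}. ?V y)"
    by (rule sum.swap_restrict) (use assms finite_outer_boundary in auto)
  also have "\<dots> = (\<Sum>x\<in>B. \<Sum>y | neighbors x y. ?V y)"
  proof (rule sum.cong[OF refl], rule sum.mono_neutral_left)
    fix x assume x: "x \<in> B"
    show "finite {y. neighbors x y}" by (simp add: neighbor_set)
    show "\<forall>y\<in>{y. neighbors x y} - {y \<in> outer_boundary B. neighbors x y}. ?V y = 0"
    proof
      fix y assume y: "y \<in> {y. neighbors x y} - {y \<in> outer_boundary B. neighbors x y}"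
      then have "y \<in> B \<or> snd y \<le> 0" using x by (auto simp: outer_boundary_def half_plane_def)
      then show "?V y = 0" using escape_on[of "absorbing B" y] escape_below[of "absorbing B" y] by auto
    qed
  qed auto
  also have "\<dots> = flux B" by (simp add: sum_neighbors flux_def)
  finally show ?thesis .
qed

lemma flux_nonneg: "0 \<le> flux B"
  unfolding flux_def by (intro sum_nonneg mult_nonneg_nonneg avg_nonneg escape_nonneg) auto

text \<open>The positive part of the height minus \<open>h\<close> is subharmonic and vanishes on
  the absorbing set, so it remains a lower bound under every killed step.\<close>

lemma escape_ge:
  assumes "\<And>b. b \<in> B \<Longrightarrow> snd b \<le> int h"
  shows "real_of_int (snd z) - real h \<le> escape (absorbing B) z"
proof -
  define D where "D z = real_of_int (max 0 (snd z - int h))" for z :: point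
  have "D z \<le> (kill (absorbing B) ^^ m) (ht_off (absorbing B)) z" for m
  proof (induction m arbitrary: z)
    case 0
    show ?case using assms[of z] by (auto simp: D_def ht_off_def ht_def line_def)
  next
    case (Suc m)
    show ?case
    proof (cases "z \<in> absorbing B")
      case True
      then have "D z = 0" using assms[of z] by (auto simp: D_def line_def)
      then show ?thesis using True by (simp add: kill_def)
    next
      case False
      have "D z \<le> avg D z" by (cases z) (auto simp: D_def avg_def max_def)
      also have "\<dots> \<le> avg ((kill (absorbing B) ^^ m) (ht_off (absorbing B))) z"
        by (rule avg_mono) (rule Suc.IH)
      finally show ?thesis using False by (simp add: kill_pow_Suc del: funpow.simps(2))
    qed
  qed
  then have "D z \<le> escape (absorbing B) z"
    by (intro LIMSEQ_le_const[OF escape_tendsto]) auto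
  then show ?thesis by (simp add: D_def)
qed

text \<open>The site above a topmost point has escape potential at least one. The quotient in
  \<open>attach_prob\<close> is therefore an honest quotient of reals.\<close>

lemma flux_ge_1:
  assumes "finite B" "B \<noteq> {}" "B \<subseteq> half_plane"
  shows "1 \<le> flux B"
proof -
  have "Max (snd ` B) \<in> snd ` B" using assms by (intro Max_in) auto
  then obtain b where b: "b \<in> B" "snd b = Max (snd ` B)" by auto
  have le: "snd x \<le> snd b" if "x \<in> B" for x using that assms b by simp
  have b0: "0 \<le> snd b" using b assms by (auto simp: half_plane_def)
  have "1 \<le> escape (absorbing B) (b + (0, 1))"
    using escape_ge[of B "nat (snd b)" "b + (0, 1)"] le b0 by auto
  also have "\<dots> \<le> 4 * avg (escape (absorbing B)) b"
    using escape_nonneg[of "absorbing B"] by (simp add: avg_def add_nonneg_nonneg)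
  also have "\<dots> \<le> flux B"
    unfolding flux_def using b assms by (intro member_le_sum) (auto intro!: avg_nonneg escape_nonneg)
  finally show ?thesis .
qed

text \<open>The energy comparison is carried out for the finite iterates \<open>f m\<close> in place
  of the escape potential. They differ from the height only on a finite set, so Green's identity has
  no term at infinity; the limit in \<open>m\<close> is taken at the end.\<close>

lemma flux_lower_bound:
  assumes B: "finite B" "B \<subseteq> half_plane" and b: "b \<in> B" "snd b = int h" "\<And>x. x \<in> B \<Longrightarrow> snd x \<le> int h"
    and h: "0 < h"
  shows "real h \<le> 2 * (1 + ln (real h)) * flux B"
proof -
  let ?K = "absorbing B"
  define f where "f m = (kill ?K ^^ m) (ht_off ?K)" for m
  define v where "v m z = ht z - f m z" for m z
  have f0: "0 \<le> f m z" for m z unfolding f_def by (rule kill_pow_nonneg) (rule ht_off_nonneg)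
  have f_le: "f m z \<le> ht_off ?K z" for m z
    unfolding f_def using kill_pow_ht_off_le[of ?K 0 m z] by simp
  have v0: "0 \<le> v m z" for m z using f_le[of m z] by (auto simp: v_def ht_off_def intro: order_trans[OF _ ht_nonneg] split: if_splits)
  have f_on: "f m z = 0" if "z \<in> ?K \<or> snd z \<le> 0" for m z
    using f0[of m z] f_le[of m z] that by (auto simp: ht_off_def ht_def split: if_splits)
  have f_Suc: "f (Suc m) z = avg (f m) z" if "z \<notin> ?K" for m z
    unfolding f_def kill_pow_Suc using that by simp
  obtain R where R: "B \<subseteq> box (0, 0) R" "int h \<le> R"
  proof -
    let ?R = "(\<Sum>x\<in>B. \<bar>fst x\<bar> + \<bar>snd x\<bar>) + int h"
    have R1: "\<bar>fst x\<bar> + \<bar>snd x\<bar> \<le> ?R" if "x \<in> B" for x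
      using member_le_sum[OF that, of "\<lambda>x. \<bar>fst x\<bar> + \<bar>snd x\<bar>"] B(1) by simp
    have "B \<subseteq> box (0, 0) ?R"
    proof
      fix x assume "x \<in> B"
      from R1[OF this] show "x \<in> box (0, 0) ?R"
        unfolding in_box_iff fst_conv snd_conv diff_0_right by linarith
    qed
    moreover have "int h \<le> ?R" by (simp add: sum_nonneg)
    ultimately show ?thesis by (rule that)
  qed
  have supp: "v m z = 0" if "z \<notin> box (0, 0) (R + int m)" for m z
    using that
  proof (induction m arbitrary: z)
    case 0
    then have "z \<notin> B" using R by auto
    then show ?case by (simp add: v_def f_def ht_off_def ht_line_0)
  next
    case (Suc m)
    have zB: "z \<notin> B" using R Suc.prems by (auto simp: in_box_iff)
    show ?case
    proof (cases "z \<in> line 0")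
      case True
      then show ?thesis using f_on[of z] by (simp add: v_def ht_line_0)
    next
      case False
      have "v m (z + e) = 0" if "e \<in> {(1, 0), (-1, 0), (0, 1), (0, -1)}" for e
        using Suc.prems that by (intro Suc.IH) (auto simp: in_box_iff)
      then have "avg (v m) z = 0" by (simp add: avg_def)
      moreover have "avg (v m) z = ht z - avg (f m) z"
        using avg_linear[of 1 ht "-1" "f m" z] False by (simp add: v_def[abs_def] avg_ht line_def)
      ultimately show ?thesis using zB False by (simp add: v_def f_Suc)
    qed
  qed
  \<comment> \<open>The radius \<open>2 R + m + 1\<close> leaves room both for the support of
    \<open>v m\<close> and for the triangle below \<open>b\<close> used later. Off \<open>B\<close>
    the function \<open>v m\<close> is subharmonic where it is not zero, so only \<open>B\<close>
    contributes, and there \<open>v m\<close> is at most \<open>h\<close>.\<close>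
  have energy: "dirichlet (box (0, 0) (2 * R + int m + 1)) (v m) (v m) \<le> real h * (\<Sum>x\<in>B. 4 * avg (f m) x)" for m
  proof -
    let ?W = "box (0, 0) (R + int m)"
    have R0: "0 \<le> R" using R(2) by simp
    have "dirichlet (box (0, 0) (2 * R + int m + 1)) (v m) (v m) = 4 * (\<Sum>z\<in>?W. v m z * (v m z - avg (v m) z))"
      using supp R0 by (intro dirichlet_green) (auto simp: in_box_iff)
    also have "\<dots> \<le> 4 * (\<Sum>z\<in>?W. if z \<in> B then real h * avg (f m) z else 0)"
    proof (intro mult_left_mono sum_mono)
      fix z
      have av: "0 \<le> avg (f m) z" by (intro avg_nonneg f0)
      show "v m z * (v m z - avg (v m) z) \<le> (if z \<in> B then real h * avg (f m) z else 0)"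
      proof (cases "snd z \<le> 0")
        case True
        then have "v m z = 0" using f_on[of z] by (simp add: v_def ht_def)
        then show ?thesis using av by simp
      next
        case False
        have "avg (v m) z = ht z - avg (f m) z"
          using avg_linear[of 1 ht "-1" "f m" z] False by (simp add: v_def[abs_def] avg_ht)
        then have d: "v m z - avg (v m) z = avg (f m) z - f m z" by (simp add: v_def)
        show ?thesis
        proof (cases "z \<in> B")
          case True
          then have "v m z \<le> real h" using b(3)[OF True] f0[of m z] by (auto simp: v_def ht_def)
          then show ?thesis using True av unfolding d by (simp add: f_on mult_right_mono)
        next
          case zB: False
          then have "z \<notin> ?K" using False by (auto simp: line_def)
          have "f (Suc m) z \<le> f m z" unfolding f_def by (rule kill_pow_ht_off_le) auto
          then have "avg (f m) z \<le> f m z" unfolding f_Suc[OF \<open>z \<notin> ?K\<close>] .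
          then show ?thesis using v0[of m z] zB unfolding d by (simp add: mult_nonneg_nonpos)
        qed
      qed
    qed simp
    also have "(\<Sum>z\<in>?W. if z \<in> B then real h * avg (f m) z else 0) = (\<Sum>z\<in>B. real h * avg (f m) z)"
      using R by (subst sum.inter_restrict[symmetric]) (auto simp: in_box_iff intro!: sum.cong)
    finally show ?thesis by (simp add: sum_distrib_left mult_ac)
  qed
  \<comment> \<open>Since \<open>f m\<close> vanishes on \<open>B\<close>, the value
    \<open>v m b\<close> is exactly \<open>h\<close>.\<close>
  have main: "(real h)\<^sup>2 \<le> 2 * (1 + ln (real h)) * (real h * (\<Sum>x\<in>B. 4 * avg (f m) x))" for m
  proof -
    have "b \<in> box (0, 0) R" using b R by auto
    then have "(v m b)\<^sup>2 \<le> 2 * (\<Sum>k<h. 1 / (real k + 1)) * dirichlet (box (0, 0) (2 * R + int m + 1)) (v m) (v m)"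
      using R f_on b by (intro point_energy_lower_bound) (auto simp: v_def ht_def in_box_iff)
    also have "\<dots> \<le> 2 * (1 + ln (real h)) * (real h * (\<Sum>x\<in>B. 4 * avg (f m) x))"
      using harmonic_sum_le[OF h] energy[of m] dirichlet_nonneg h
      by (intro mult_mono) (auto simp: ln_ge_zero intro!: sum_nonneg)
    finally show ?thesis using b f_on[of b m] by (simp add: v_def ht_def)
  qed
  have "(\<lambda>m. 2 * (1 + ln (real h)) * (real h * (\<Sum>x\<in>B. 4 * avg (f m) x))) \<longlonglongrightarrow>
      2 * (1 + ln (real h)) * (real h * flux B)"
    unfolding flux_def f_def by (intro tendsto_intros avg_tendsto escape_tendsto) auto
  then have "(real h)\<^sup>2 \<le> 2 * (1 + ln (real h)) * (real h * flux B)"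
    by (rule LIMSEQ_le_const) (use main in auto)
  then have "real h * real h \<le> real h * (2 * (1 + ln (real h)) * flux B)"
    by (simp add: power2_eq_square mult_ac)
  then show ?thesis using h by (simp add: mult_le_cancel_left_pos)
qed

section \<open>Attachment probabilities\<close>

lemma attach_prob_eq:
  assumes "finite B" "B \<noteq> {}" "B \<subseteq> half_plane" "y \<in> outer_boundary B"
  shows "attach_prob B y = (\<Sum>x\<in>{x \<in> B. neighbors x y}. escape (absorbing B) y) / flux B"
  unfolding attach_prob_def using flux_ge_1[OF assms(1-3)] assms
  by (simp add: harmonic_point_eq harmonic_total_eq divide_ennreal sum_nonneg escape_nonneg)

text \<open>The process fixes only the probability of each single attachment; total mass one
  excludes, up to null sets, any other transition from a nonempty cluster.\<close>

lemma sum_attach_prob: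
  assumes "finite B" "B \<noteq> {}" "B \<subseteq> half_plane"
  shows "(\<Sum>y\<in>outer_boundary B. attach_prob B y) = 1"
proof -
  have "ennreal (\<Sum>y\<in>outer_boundary B. \<Sum>x\<in>{x \<in> B. neighbors x y}. escape (absorbing B) y) = harmonic_total B"
    unfolding harmonic_total_def using assms
    by (simp add: harmonic_point_eq sum_ennreal sum_nonneg escape_nonneg)
  also have "\<dots> = ennreal (flux B)" using assms by (simp add: harmonic_total_eq)
  finally have "(\<Sum>y\<in>outer_boundary B. \<Sum>x\<in>{x \<in> B. neighbors x y}. escape (absorbing B) y) = flux B"
    by (subst (asm) ennreal_inj) (auto intro!: sum_nonneg mult_nonneg_nonneg escape_nonneg flux_nonneg)
  then show ?thesis using flux_ge_1[OF assms]
    by (simp add: attach_prob_eq[OF assms] sum_divide_distrib[symmetric])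
qed

lemma escape_antimono:
  assumes "line 0 \<subseteq> K" "K \<subseteq> K'"
  shows "escape K' z \<le> escape K z"
proof -
  have "(kill K' ^^ m) (ht_off K') z \<le> (kill K ^^ m) (ht_off K) z" for m
  proof (induction m arbitrary: z)
    case (Suc m)
    show ?case
    proof (cases "z \<in> K'")
      case True
      then show ?thesis using kill_pow_nonneg[of "ht_off K" "Suc m" K z, OF ht_off_nonneg]
        by (simp add: kill_pow_Suc del: funpow.simps(2))
    next
      case False
      then show ?thesis using assms(2) avg_mono[OF Suc.IH]
        by (auto simp: kill_pow_Suc simp del: funpow.simps(2))
    qed
  qed (use assms in \<open>auto simp: ht_off_def\<close>)
  then show ?thesis using assms
    by (intro LIMSEQ_le[OF escape_tendsto[of K'] escape_tendsto[of K]]) auto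
qed

text \<open>At most four edges end at \<open>y\<close>, and \<open>flux_lower_bound\<close>
  contributes another factor two. Shrinking the obstacle from \<open>B\<close> to \<open>D\<close>
  enlarges the potential, so the bound forgets all of the cluster except \<open>D\<close>.\<close>

lemma attach_prob_le:
  assumes B: "finite B" "B \<subseteq> half_plane" and y: "y \<in> outer_boundary B" and D: "D \<subseteq> B"
    and x: "x \<in> B" "int h \<le> snd x" and h: "0 < h"
  shows "attach_prob B y \<le> 8 * (1 + ln (real h)) / real h * escape (absorbing D) y"
proof -
  let ?V = "escape (absorbing B) y"
  have ne: "B \<noteq> {}" using x by auto
  have F: "1 \<le> flux B" using B ne by (intro flux_ge_1)
  have V0: "0 \<le> ?V" by (rule escape_nonneg) simp
  have "Max (snd ` B) \<in> snd ` B" using B ne by (intro Max_in) auto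
  then obtain b where b: "b \<in> B" "snd b = Max (snd ` B)" by auto
  define H where "H = nat (snd b)"
  have le: "snd z \<le> snd b" if "z \<in> B" for z using that B b by simp
  have hH: "h \<le> H" using le[OF x(1)] x(2) unfolding H_def by linarith
  have H: "int H = snd b" using hH h by (auto simp: H_def)
  have "real H \<le> 2 * (1 + ln (real H)) * flux B"
    by (rule flux_lower_bound[OF B b(1)]) (use le H h hH in auto)
  \<comment> \<open>The function \<open>(1 + ln t) / t\<close> decreases for \<open>t\<close> at
    least one, which replaces the true height \<open>H\<close> by the smaller
    \<open>h\<close>.\<close>
  moreover have "real h * (1 + ln (real H)) \<le> real H * (1 + ln (real h))"
  proof -
    have "ln (real H / real h) \<le> real H / real h - 1" using h hH by (intro ln_le_minus_one) auto
    then have "real h * (ln (real H) - ln (real h)) \<le> real h * (real H / real h - 1)"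
      using h hH by (intro mult_left_mono) (auto simp: ln_div)
    also have "\<dots> = real H - real h" using h by (simp add: field_simps)
    finally have "real h * (1 + ln (real H)) \<le> real H + real h * ln (real h)" by (simp add: algebra_simps)
    also have "\<dots> \<le> real H + real H * ln (real h)" using h hH by (intro add_mono mult_right_mono) (auto simp: ln_ge_zero)
    finally show ?thesis by (simp add: algebra_simps)
  qed
  ultimately have "real h * (1 + ln (real H)) \<le> (2 * (1 + ln (real H)) * flux B) * (1 + ln (real h))"
    using h by (smt (verit, best) ln_ge_zero mult_right_mono of_nat_1 of_nat_le_iff One_nat_def Suc_leI)
  then have "(1 + ln (real H)) * real h \<le> (1 + ln (real H)) * (2 * (1 + ln (real h)) * flux B)" by (simp add: algebra_simps)
  moreover have "0 < 1 + ln (real H)" using h hH by (simp add: ln_ge_zero add_pos_nonneg)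
  ultimately have hF: "real h \<le> 2 * (1 + ln (real h)) * flux B" by (simp only: mult_le_cancel_left_pos)
  have "card {x \<in> B. neighbors x y} \<le> card {x. neighbors y x}"
  proof (rule card_mono)
    show "finite {x. neighbors y x}" by (simp add: neighbor_set)
    show "{x \<in> B. neighbors x y} \<subseteq> {x. neighbors y x}" by (auto intro: neighbors_sym)
  qed
  also have "\<dots> \<le> 4" unfolding neighbor_set by (intro card_insert_le_m1) auto
  finally have card: "card {x \<in> B. neighbors x y} \<le> 4" .
  have "attach_prob B y = card {x \<in> B. neighbors x y} * ?V / flux B"
    using attach_prob_eq[OF B(1) ne B(2) y] by simp
  also have "\<dots> \<le> 4 * ?V / flux B"
    using card V0 F by (intro divide_right_mono mult_right_mono) auto
  also have "\<dots> \<le> 4 * ?V * (2 * (1 + ln (real h)) / real h)"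
  proof -
    have "1 / flux B \<le> 2 * (1 + ln (real h)) / real h" using hF F h by (simp add: field_simps)
    then have "4 * ?V * (1 / flux B) \<le> 4 * ?V * (2 * (1 + ln (real h)) / real h)"
      using V0 by (intro mult_left_mono) auto
    then show ?thesis by simp
  qed
  also have "\<dots> = 8 * (1 + ln (real h)) / real h * ?V" by simp
  also have "\<dots> \<le> 8 * (1 + ln (real h)) / real h * escape (absorbing D) y"
    using D h by (intro mult_left_mono escape_antimono) (auto simp: ln_ge_zero intro!: divide_nonneg_nonneg add_nonneg_nonneg)
  finally show ?thesis .
qed

section \<open>Growing clusters contain chains\<close>

text \<open>The head of the list is the point attached last.\<close>

fun chain :: "(nat \<Rightarrow> point set) \<Rightarrow> point list \<Rightarrow> nat \<Rightarrow> bool" where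
  "chain a [] t \<longleftrightarrow> True"
| "chain a [x] t \<longleftrightarrow> x \<in> a t"
| "chain a (x # x' # xs) t \<longleftrightarrow> (\<exists>s<t. chain a (x' # xs) s \<and> set (x' # xs) \<subseteq> a s \<and>
     x \<in> outer_boundary (a s) \<and> a (Suc s) = a s \<union> {x})"

text \<open>A chain up to time \<open>t\<close> depends only on the clusters up to \<open>t\<close>,
  which makes it an event of the history.\<close>

lemma chain_cong: "(\<And>i. i \<le> t \<Longrightarrow> a i = a' i) \<Longrightarrow> chain a xs t \<longleftrightarrow> chain a' xs t"
proof (induction a xs t rule: chain.induct)
  case (3 a x x' xs t)
  have eq: "chain a (x' # xs) s \<longleftrightarrow> chain a' (x' # xs) s" "a s = a' s" "a (Suc s) = a' (Suc s)" if "s < t" for s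
    using 3 that by auto
  show ?case unfolding chain.simps by (intro ex_cong1 conj_cong refl) (simp_all only: eq)
qed auto

definition growth :: "(nat \<Rightarrow> point set) \<Rightarrow> bool" where
  "growth a \<longleftrightarrow> a 0 = {(0, 0)} \<and> (\<forall>n. \<exists>y\<in>outer_boundary (a n). a (Suc n) = a n \<union> {y})"

lemma growth_step:
  assumes "growth a"
  obtains y where "y \<in> outer_boundary (a n)" "a (Suc n) = a n \<union> {y}"
  using assms unfolding growth_def by blast

lemma growth_mono: "growth a \<Longrightarrow> m \<le> n \<Longrightarrow> a m \<subseteq> a n"
  by (rule lift_Suc_mono_le[of a]) (auto simp: growth_def)

lemma growth_finite: "growth a \<Longrightarrow> finite (a n)"
proof (induction n)
  case (Suc n)
  then show ?case unfolding growth_def by (metis finite.emptyI finite_UnI finite_insert)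
qed (simp add: growth_def)

lemma growth_origin: "growth a \<Longrightarrow> (0, 0) \<in> a n"
  using growth_mono[of a 0 n] by (auto simp: growth_def)

lemma growth_box: "growth a \<Longrightarrow> a n \<subseteq> box (0, 0) (int n)"
proof (induction n)
  case (Suc n)
  obtain y where y: "y \<in> outer_boundary (a n)" "a (Suc n) = a n \<union> {y}"
    using growth_step[OF Suc.prems] by blast
  obtain x where "x \<in> a n" "neighbors x y" using y by (auto simp: outer_boundary_def)
  moreover from this have "x \<in> box (0, 0) (int n)" using Suc by blast
  ultimately have "y \<in> box (0, 0) (int (Suc n))" by (auto simp: neighbors_def in_box_iff)
  then show ?case using y Suc by (auto simp: in_box_iff)
qed (auto simp: growth_def in_box_iff)

lemma growth_parent:
  assumes a: "growth a" and x: "x \<in> a t" "x \<noteq> (0, 0)"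
  obtains s x' where "s < t" "x' \<in> a s" "neighbors x' x" "x \<in> outer_boundary (a s)" "a (Suc s) = a s \<union> {x}"
proof -
  have "\<exists>s x'. s < t \<and> x' \<in> a s \<and> neighbors x' x \<and> x \<in> outer_boundary (a s) \<and> a (Suc s) = a s \<union> {x}"
    using x
  proof (induction t)
    case 0
    then show ?case using a by (simp add: growth_def)
  next
    case (Suc t)
    show ?case
    proof (cases "x \<in> a t")
      case True
      then show ?thesis using Suc less_SucI by blast
    next
      case False
      obtain y where y: "y \<in> outer_boundary (a t)" "a (Suc t) = a t \<union> {y}"
        using growth_step[OF a] by blast
      then have "y = x" using False Suc.prems by auto
      then show ?thesis using y by (auto simp: outer_boundary_def intro!: exI[of _ t])
    qed
  qed
  then show ?thesis using that by blast
qed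

text \<open>The chain traces ancestors back in time. Each generation lowers the height by at most
  one, so the origin is not reached too early.\<close>

lemma growth_chain:
  assumes a: "growth a"
  shows "x \<in> a t \<Longrightarrow> int l \<le> snd x \<Longrightarrow>
    \<exists>xs. hd xs = x \<and> length xs = Suc l \<and> successively neighbors xs \<and> chain a xs t \<and> set xs \<subseteq> a t"
proof (induction l arbitrary: x t)
  case 0
  then show ?case by (intro exI[of _ "[x]"]) auto
next
  case (Suc l)
  then have "x \<noteq> (0, 0)" by auto
  from growth_parent[OF a Suc.prems(1) this] obtain s x' where
    s: "s < t" "x' \<in> a s" "neighbors x' x" "x \<in> outer_boundary (a s)" "a (Suc s) = a s \<union> {x}" .
  have "int l \<le> snd x'" using s(3) Suc.prems(2) by (auto simp: neighbors_def)
  from Suc.IH[OF s(2) this] obtain xs where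
    xs: "hd xs = x'" "length xs = Suc l" "successively neighbors xs" "chain a xs s" "set xs \<subseteq> a s" by blast
  obtain ys where ys: "xs = x' # ys" using xs by (cases xs) auto
  have "a s \<subseteq> a t" using growth_mono[OF a] s(1) by simp
  then show ?case
    using xs s Suc.prems(1) neighbors_sym[OF s(3)] unfolding ys
    by (intro exI[of _ "x # x' # ys"]) auto
qed

text \<open>Ancestors lead back to the origin and heights change by at most one per generation, so
  no level is skipped.\<close>

lemma growth_intermediate_height:
  assumes a: "growth a"
  shows "x \<in> a t \<Longrightarrow> int l \<le> snd x \<Longrightarrow> \<exists>x\<in>a t. snd x = int l"
proof (induction t arbitrary: x rule: less_induct)
  case (less t)
  show ?case
  proof (cases "snd x = int l")
    case False
    then have l: "int l < snd x" using less.prems by simp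
    then have "x \<noteq> (0, 0)" by auto
    from growth_parent[OF a less.prems(1) this] obtain s x' where
      s: "s < t" "x' \<in> a s" "neighbors x' x" "x \<in> outer_boundary (a s)" "a (Suc s) = a s \<union> {x}" .
    then have "\<exists>x\<in>a s. snd x = int l" using l by (intro less.IH[of s x']) (auto simp: neighbors_def)
    then show ?thesis using growth_mono[OF a, of s t] s(1) by auto
  qed (use less.prems in blast)
qed

section \<open>Attachment probabilities along a history\<close>

locale dla = prob_space M for M :: "'a measure" +
  fixes A :: "nat \<Rightarrow> 'a \<Rightarrow> point set"
  assumes process: "dla_process M A"
begin

definition clusters :: "point set set" where
  "clusters = {B. finite B \<and> B \<subseteq> half_plane}"

text \<open>Histories take countably many values, so every event about the past is a countable union
  of atoms.\<close>

definition hist :: "nat \<Rightarrow> 'a \<Rightarrow> point set list" where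
  "hist n \<omega> = map (\<lambda>i. A i \<omega>) [0..<Suc n]"

lemma countable_histories: "countable (lists clusters)"
  unfolding clusters_def
  by (intro countable_lists countable_subset[OF _ countable_Collect_finite]) auto

lemma A_in_clusters: "\<omega> \<in> space M \<Longrightarrow> A n \<omega> \<in> clusters"
  using process measurable_space[of "A n" M "count_space clusters" \<omega>]
  by (simp add: dla_process_def clusters_def)

lemma nth_hist: "i \<le> n \<Longrightarrow> hist n \<omega> ! i = A i \<omega>"
  by (simp add: hist_def del: upt_Suc)

lemma take_hist: "take (Suc n) (hist (Suc n) \<omega>) = hist n \<omega>"
  unfolding hist_def take_map by simp

lemma length_hist [simp]: "length (hist n \<omega>) = Suc n"
  by (simp add: hist_def)

lemma hist_in: "\<omega> \<in> space M \<Longrightarrow> hist n \<omega> \<in> lists clusters"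
  unfolding hist_def using A_in_clusters by auto

lemma hist_eq_iff: "hist n \<omega> = bs \<longleftrightarrow> length bs = Suc n \<and> (\<forall>i\<le>n. A i \<omega> = bs ! i)"
  by (auto simp: list_eq_iff_nth_eq nth_hist less_Suc_eq_le)

lemma A_eq_measurable: "{\<omega> \<in> space M. A i \<omega> = B} \<in> events"
proof (cases "B \<in> clusters")
  case True
  have "A i \<in> M \<rightarrow>\<^sub>M count_space clusters" using process by (simp add: dla_process_def clusters_def)
  then have "A i -` {B} \<inter> space M \<in> events" using True by (intro measurable_sets) auto
  moreover have "A i -` {B} \<inter> space M = {\<omega> \<in> space M. A i \<omega> = B}" by auto
  ultimately show ?thesis by simp
next
  case False
  then have "{\<omega> \<in> space M. A i \<omega> = B} = {}" using A_in_clusters by auto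
  then show ?thesis by (simp only: sets.empty_sets)
qed

lemma hist_eq_measurable: "{\<omega> \<in> space M. hist n \<omega> = bs} \<in> events"
proof -
  have "{\<omega> \<in> space M. hist n \<omega> = bs} =
      (if length bs = Suc n then (\<Inter>i\<in>{..n}. {\<omega> \<in> space M. A i \<omega> = bs ! i}) else {})"
    by (auto simp: hist_eq_iff)
  moreover have "(\<Inter>i\<in>{..n}. {\<omega> \<in> space M. A i \<omega> = bs ! i}) \<in> events"
    by (rule sets.finite_INT) (auto intro: A_eq_measurable)
  ultimately show ?thesis by simp
qed

lemma history_event_UN:
  "{\<omega> \<in> space M. Q (hist n \<omega>)} = (\<Union>bs\<in>{bs \<in> lists clusters. Q bs}. {\<omega> \<in> space M. hist n \<omega> = bs})"
  using hist_in by auto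

lemma history_event_measurable: "{\<omega> \<in> space M. Q (hist n \<omega>)} \<in> events"
  unfolding history_event_UN
  by (intro sets.countable_UN') (auto intro: hist_eq_measurable countable_subset[OF _ countable_histories])

lemma prob_attach:
  assumes "0 < prob {\<omega> \<in> space M. hist n \<omega> = bs}" "y \<in> outer_boundary (bs ! n)"
  shows "prob {\<omega> \<in> space M. hist n \<omega> = bs \<and> A (Suc n) \<omega> = bs ! n \<union> {y}} =
    attach_prob (bs ! n) y * prob {\<omega> \<in> space M. hist n \<omega> = bs}"
proof -
  have len: "length bs = Suc n"
  proof (rule ccontr)
    assume "length bs \<noteq> Suc n"
    then have "{\<omega> \<in> space M. hist n \<omega> = bs} = {}" by (simp add: hist_eq_iff)
    with assms(1) show False by simp
  qed
  have eq: "hist n \<omega> = bs \<longleftrightarrow> (\<forall>i\<le>n. A i \<omega> = bs ! i)" for \<omega> using len by (simp add: hist_eq_iff)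
  have "\<P>(\<omega> in M. A (Suc n) \<omega> = bs ! n \<union> {y} \<bar> \<forall>i\<le>n. A i \<omega> = bs ! i) = attach_prob (bs ! n) y"
    using process assms unfolding dla_process_def eq by blast
  then show ?thesis using assms(1) unfolding eq cond_prob_def by (simp add: field_simps conj_commute)
qed

text \<open>The one-step bound is applied to each admissible history and summed over the disjoint,
  countably many histories.\<close>

lemma prob_attach_le:
  assumes \<alpha>: "0 \<le> \<alpha>" and Q: "\<And>bs. bs \<in> lists clusters \<Longrightarrow> length bs = Suc n \<Longrightarrow> Q bs \<Longrightarrow> y \<in> outer_boundary (bs ! n) \<Longrightarrow>
      attach_prob (bs ! n) y \<le> \<alpha>"
  shows "prob {\<omega> \<in> space M. Q (hist n \<omega>) \<and> y \<in> outer_boundary (A n \<omega>) \<and> A (Suc n) \<omega> = A n \<omega> \<union> {y}}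
    \<le> \<alpha> * prob {\<omega> \<in> space M. Q (hist n \<omega>)}"
proof -
  define I where "I = {bs \<in> lists clusters. length bs = Suc n \<and> Q bs \<and> y \<in> outer_boundary (bs ! n)}"
  define X where "X bs = {\<omega> \<in> space M. hist n \<omega> = bs \<and> A (Suc n) \<omega> = bs ! n \<union> {y}}" for bs
  define Y where "Y bs = {\<omega> \<in> space M. hist n \<omega> = bs}" for bs
  have I: "countable I" unfolding I_def by (rule countable_subset[OF _ countable_histories]) auto
  have X: "X bs \<in> events" for bs
    unfolding X_def by (rule sets.sets_Collect_conj[OF A_eq_measurable hist_eq_measurable])
  have Y: "Y bs \<in> events" for bs unfolding Y_def by (rule hist_eq_measurable)
  have le: "emeasure M (X bs) \<le> ennreal \<alpha> * emeasure M (Y bs)" if "bs \<in> I" for bs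
  proof (cases "prob (Y bs) = 0")
    \<comment> \<open>On a null history the transition law is unspecified, but both sides
      vanish.\<close>
    case True
    have "prob (X bs) \<le> prob (Y bs)" by (rule finite_measure_mono) (use Y in \<open>auto simp: X_def Y_def\<close>)
    then have "emeasure M (X bs) = 0" using True by (simp add: emeasure_eq_measure measure_le_0_iff)
    then show ?thesis by simp
  next
    case False
    then have "0 < prob (Y bs)" by (simp add: zero_less_measure_iff)
    then have "prob (X bs) = attach_prob (bs ! n) y * prob (Y bs)"
      using that unfolding X_def Y_def I_def by (intro prob_attach) auto
    also have "\<dots> \<le> \<alpha> * prob (Y bs)" using that unfolding I_def by (intro mult_right_mono Q) auto
    finally show ?thesis using \<alpha> by (simp add: emeasure_eq_measure ennreal_mult[symmetric])
  qed
  have "{\<omega> \<in> space M. Q (hist n \<omega>) \<and> y \<in> outer_boundary (A n \<omega>) \<and> A (Suc n) \<omega> = A n \<omega> \<union> {y}} = (\<Union>bs\<in>I. X bs)"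
    using hist_in[of _ n] by (auto simp: I_def X_def nth_hist)
  then have "emeasure M {\<omega> \<in> space M. Q (hist n \<omega>) \<and> y \<in> outer_boundary (A n \<omega>) \<and> A (Suc n) \<omega> = A n \<omega> \<union> {y}}
      = emeasure M (\<Union>bs\<in>I. X bs)" by simp
  also have "\<dots> = (\<integral>\<^sup>+bs. emeasure M (X bs) \<partial>count_space I)"
    by (rule emeasure_UN_countable) (use I X in \<open>auto simp: disjoint_family_on_def X_def\<close>)
  also have "\<dots> \<le> (\<integral>\<^sup>+bs. ennreal \<alpha> * emeasure M (Y bs) \<partial>count_space I)"
    by (intro nn_integral_mono) (use le in auto)
  also have "\<dots> = ennreal \<alpha> * (\<integral>\<^sup>+bs. emeasure M (Y bs) \<partial>count_space I)"
    by (rule nn_integral_cmult) simp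
  also have "(\<integral>\<^sup>+bs. emeasure M (Y bs) \<partial>count_space I) = emeasure M (\<Union>bs\<in>I. Y bs)"
    by (rule emeasure_UN_countable[symmetric]) (use I Y in \<open>auto simp: disjoint_family_on_def Y_def\<close>)
  also have "\<dots> \<le> emeasure M {\<omega> \<in> space M. Q (hist n \<omega>)}"
    by (rule emeasure_mono) (auto simp: Y_def I_def intro: history_event_measurable)
  finally show ?thesis using \<alpha>
    by (simp add: emeasure_eq_measure ennreal_mult[symmetric] mult_left_mono)
qed

text \<open>For a fixed history with nonempty last cluster, the disjoint attachment events exhaust
  its probability by \<open>sum_attach_prob\<close>. The exceptional null sets are united over
  countably many histories.\<close>

lemma AE_attach: "AE \<omega> in M. A n \<omega> \<noteq> {} \<longrightarrow> (\<exists>y\<in>outer_boundary (A n \<omega>). A (Suc n) \<omega> = A n \<omega> \<union> {y})"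
proof -
  have "AE \<omega> in M. hist n \<omega> = bs \<longrightarrow> bs ! n \<noteq> {} \<longrightarrow> (\<exists>y\<in>outer_boundary (bs ! n). A (Suc n) \<omega> = bs ! n \<union> {y})"
    if bs: "bs \<in> lists clusters" for bs
  proof (cases "0 < prob {\<omega> \<in> space M. hist n \<omega> = bs} \<and> bs ! n \<noteq> {}")
    case False
    show ?thesis
    proof (cases "bs ! n = {}")
      case ne: False
      then have "prob {\<omega> \<in> space M. hist n \<omega> = bs} = 0" using False by (simp add: zero_less_measure_iff)
      then have "AE \<omega> in M. \<not> hist n \<omega> = bs"
        by (subst AE_iff_measurable[OF hist_eq_measurable[of n bs]]) (auto simp: emeasure_eq_measure)
      then show ?thesis by eventually_elim simp
    qed simp
  next
    case True
    let ?Y = "{\<omega> \<in> space M. hist n \<omega> = bs}"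
    let ?X = "\<lambda>y. {\<omega> \<in> space M. hist n \<omega> = bs \<and> A (Suc n) \<omega> = bs ! n \<union> {y}}"
    have len: "length bs = Suc n"
    proof (rule ccontr)
      assume "length bs \<noteq> Suc n"
      then have "?Y = {}" by (simp add: hist_eq_iff)
      with True show False by simp
    qed
    have B: "finite (bs ! n)" "bs ! n \<subseteq> half_plane" using bs len by (auto simp: clusters_def in_lists_conv_set)
    have X: "?X y \<in> events" for y by (rule sets.sets_Collect_conj[OF A_eq_measurable hist_eq_measurable])
    have "prob (\<Union>y\<in>outer_boundary (bs ! n). ?X y) = (\<Sum>y\<in>outer_boundary (bs ! n). prob (?X y))"
    proof (rule finite_measure_finite_Union)
      show "disjoint_family_on ?X (outer_boundary (bs ! n))"
        unfolding disjoint_family_on_def outer_boundary_def by auto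
    qed (use B finite_outer_boundary X in auto)
    also have "\<dots> = (\<Sum>y\<in>outer_boundary (bs ! n). attach_prob (bs ! n) y * prob ?Y)"
      using True by (intro sum.cong refl prob_attach) auto
    also have "\<dots> = prob ?Y" using sum_attach_prob[of "bs ! n"] B True by (simp add: sum_distrib_right[symmetric])
    finally have eq: "prob (\<Union>y\<in>outer_boundary (bs ! n). ?X y) = prob ?Y" .
    have U: "(\<Union>y\<in>outer_boundary (bs ! n). ?X y) \<in> events"
      using B finite_outer_boundary X by (intro sets.finite_UN) auto
    have "prob (?Y - (\<Union>y\<in>outer_boundary (bs ! n). ?X y)) = 0"
      using eq U hist_eq_measurable[of n bs] by (subst finite_measure_Diff) auto
    then have "AE \<omega> in M. \<not> (hist n \<omega> = bs \<and> \<not> (\<exists>y\<in>outer_boundary (bs ! n). A (Suc n) \<omega> = bs ! n \<union> {y}))"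
      using U hist_eq_measurable[of n bs]
      by (subst AE_iff_measurable[of "?Y - (\<Union>y\<in>outer_boundary (bs ! n). ?X y)"]) (auto simp: emeasure_eq_measure)
    then show ?thesis by eventually_elim auto
  qed
  then have "AE \<omega> in M. \<forall>bs\<in>lists clusters. hist n \<omega> = bs \<longrightarrow> bs ! n \<noteq> {} \<longrightarrow>
      (\<exists>y\<in>outer_boundary (bs ! n). A (Suc n) \<omega> = bs ! n \<union> {y})"
    by (intro AE_ball_countable[THEN iffD2] countable_histories) auto
  then show ?thesis using AE_space
    by eventually_elim (use hist_in nth_hist in fastforce)
qed

lemma AE_growth: "AE \<omega> in M. growth (\<lambda>n. A n \<omega>)"
proof -
  have "AE \<omega> in M. A 0 \<omega> = {(0, 0)}" using process by (simp add: dla_process_def)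
  moreover have "AE \<omega> in M. \<forall>n. A n \<omega> \<noteq> {} \<longrightarrow> (\<exists>y\<in>outer_boundary (A n \<omega>). A (Suc n) \<omega> = A n \<omega> \<union> {y})"
    unfolding AE_all_countable by (intro allI AE_attach)
  ultimately show ?thesis
  proof eventually_elim
    case (elim \<omega>)
    have "A n \<omega> \<noteq> {}" for n
    proof (induction n)
      case (Suc n)
      then show ?case using elim(2) by auto
    qed (simp add: elim)
    then show ?case using elim by (simp add: growth_def)
  qed
qed

section \<open>The probability of a chain\<close>

lemma chain_hist: "s \<le> t \<Longrightarrow> chain (\<lambda>i. A i \<omega>) xs s \<longleftrightarrow> chain (nth (hist t \<omega>)) xs s"
  by (rule chain_cong) (simp add: nth_hist)

lemma chain_measurable: "{\<omega> \<in> space M. chain (\<lambda>i. A i \<omega>) xs t} \<in> events"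
  unfolding chain_hist[OF order_refl] by (rule history_event_measurable)

text \<open>Union bound over the time \<open>s\<close> of the last attachment. Given the history up
  to \<open>s\<close>, which already contains the rest of the path, \<open>attach_prob_le\<close>
  applies with the rest as obstacle. The binomial coefficient counts the possible attachment
  times.\<close>

lemma prob_chain_le:
  assumes "xs \<noteq> []" "\<And>x. x \<in> set xs \<Longrightarrow> int h \<le> snd x" "0 < h"
  shows "prob {\<omega> \<in> space M. chain (\<lambda>i. A i \<omega>) xs t} \<le>
    real (t choose (length xs - 1)) * (8 * (1 + ln (real h)) / real h) ^ (length xs - 1) * prod_list (path_escapes xs)"
  using assms(1,2)
proof (induction xs arbitrary: t rule: path_escapes.induct)
  case (1 x x' xs)
  define c where "c = 8 * (1 + ln (real h)) / real h"
  define E where "E = escape (absorbing (set (x' # xs))) x"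
  define k where "k = length xs"
  define Q where "Q s bs \<longleftrightarrow> chain (nth bs) (x' # xs) s \<and> set (x' # xs) \<subseteq> bs ! s" for s :: nat and bs
  define X where "X s = {\<omega> \<in> space M. Q s (hist s \<omega>) \<and> x \<in> outer_boundary (A s \<omega>) \<and> A (Suc s) \<omega> = A s \<omega> \<union> {x}}" for s
  have c: "0 \<le> c" using assms(3) by (simp add: c_def ln_ge_zero add_nonneg_nonneg)
  have E: "0 \<le> E" unfolding E_def by (rule escape_nonneg) (rule Un_upper2)
  have Q_iff: "Q s (hist s \<omega>) \<longleftrightarrow> chain (\<lambda>i. A i \<omega>) (x' # xs) s \<and> set (x' # xs) \<subseteq> A s \<omega>" for s \<omega>
    by (simp add: Q_def chain_hist[OF order_refl] nth_hist)
  have X_events: "X s \<in> events" for s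
  proof -
    \<comment> \<open>The event looks one step beyond time \<open>s\<close>, so it is expressed
      through the history of length one more.\<close>
    let ?Q = "\<lambda>bs. Q s (take (Suc s) bs) \<and> x \<in> outer_boundary (bs ! s) \<and> bs ! Suc s = bs ! s \<union> {x}"
    have "X s = {\<omega> \<in> space M. ?Q (hist (Suc s) \<omega>)}"
      by (simp add: X_def nth_hist take_hist)
    then show ?thesis using history_event_measurable[of ?Q "Suc s"] by metis
  qed
  have X: "prob (X s) \<le> c * E * (real (s choose k) * c ^ k * prod_list (path_escapes (x' # xs)))" for s
  proof -
    have "prob (X s) \<le> c * E * prob {\<omega> \<in> space M. Q s (hist s \<omega>)}"
      unfolding X_def
    proof (rule prob_attach_le)
      fix bs assume bs: "bs \<in> lists clusters" "length bs = Suc s" "Q s bs" "x \<in> outer_boundary (bs ! s)"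
      have "bs ! s \<in> clusters" using bs by (auto simp: in_lists_conv_set)
      then show "attach_prob (bs ! s) x \<le> c * E"
        unfolding c_def E_def using bs assms(3) 1(3)[of x']
        by (intro attach_prob_le[where x = x']) (auto simp: clusters_def Q_def)
    qed (use c E in simp)
    also have "prob {\<omega> \<in> space M. Q s (hist s \<omega>)} \<le> prob {\<omega> \<in> space M. chain (\<lambda>i. A i \<omega>) (x' # xs) s}"
      by (rule finite_measure_mono) (auto simp: Q_def chain_hist[OF order_refl] intro: chain_measurable[unfolded chain_hist[OF order_refl]])
    also have "\<dots> \<le> real (s choose k) * c ^ k * prod_list (path_escapes (x' # xs))"
      using 1(1)[of s] 1(3) by (simp add: c_def k_def)
    finally show ?thesis using c E by (simp add: mult_left_mono)
  qed
  have "{\<omega> \<in> space M. chain (\<lambda>i. A i \<omega>) (x # x' # xs) t} = (\<Union>s\<in>{..<t}. X s)"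
    by (auto simp: X_def Q_iff)
  then have "prob {\<omega> \<in> space M. chain (\<lambda>i. A i \<omega>) (x # x' # xs) t} \<le> (\<Sum>s<t. prob (X s))"
    using X_events by (simp only:) (rule finite_measure_subadditive_finite, auto)
  also have "\<dots> \<le> (\<Sum>s<t. c * E * (real (s choose k) * c ^ k * prod_list (path_escapes (x' # xs))))"
    by (intro sum_mono X)
  also have "\<dots> = real (\<Sum>s<t. s choose k) * c ^ Suc k * (E * prod_list (path_escapes (x' # xs)))"
    by (simp add: sum_distrib_right sum_distrib_left mult_ac)
  \<comment> \<open>The hockey-stick identity; the strict bound \<open>s < t\<close> accounts for
    \<open>t\<close> instead of \<open>t + 1\<close>.\<close>
  also have "(\<Sum>s<t. s choose k) = t choose Suc k"
  proof (cases t)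
    case (Suc m)
    then show ?thesis using sum_choose_upper[of k m] by (simp add: lessThan_Suc_atMost)
  qed simp
  finally show ?case by (simp add: c_def k_def E_def)
qed (auto intro: prob_le_1)

end

section \<open>Counting chains\<close>

text \<open>A path of \<open>h\<close> steps from height \<open>2 h\<close> stays at height at least
  \<open>h\<close>, as \<open>prob_chain_le\<close> demands. The box contains every cluster
  reachable by time \<open>n\<close>.\<close>

definition tips :: "nat \<Rightarrow> nat \<Rightarrow> point list set" where
  "tips n h = {xs. length xs = Suc h \<and> successively neighbors xs \<and>
     hd xs \<in> box (0, 0) (int n) \<and> snd (hd xs) = 2 * int h}"

lemma neighbor_paths_card:
  "finite {xs. length xs = Suc h \<and> successively neighbors xs \<and> hd xs = c} \<and>
   card {xs. length xs = Suc h \<and> successively neighbors xs \<and> hd xs = c} \<le> 4 ^ h"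
  (is "finite (?W h c) \<and> card (?W h c) \<le> 4 ^ h")
proof (induction h arbitrary: c)
  case 0
  have "?W 0 c = {[c]}" by (auto simp: length_Suc_conv)
  then show ?case by simp
next
  case (Suc h)
  let ?N = "{c'. neighbors c c'}"
  have sub: "?W (Suc h) c \<subseteq> (\<Union>c'\<in>?N. (#) c ` ?W h c')"
  proof
    fix xs assume "xs \<in> ?W (Suc h) c"
    then obtain c' ys where "xs = c # c' # ys" "length ys = h" "successively neighbors (c' # ys)" "neighbors c c'"
      by (auto simp: length_Suc_conv)
    then show "xs \<in> (\<Union>c'\<in>?N. (#) c ` ?W h c')" by (intro UN_I[of c'] image_eqI[of _ _ "c' # ys"]) auto
  qed
  have N: "finite ?N" "card ?N \<le> 4" unfolding neighbor_set by (auto intro!: card_insert_le_m1)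
  have fin: "finite (\<Union>c'\<in>?N. (#) c ` ?W h c')" using N Suc.IH by auto
  have "card (?W (Suc h) c) \<le> card (\<Union>c'\<in>?N. (#) c ` ?W h c')" by (rule card_mono[OF fin sub])
  also have "\<dots> \<le> (\<Sum>c'\<in>?N. card ((#) c ` ?W h c'))" by (rule card_UN_le[OF N(1)])
  also have "\<dots> \<le> (\<Sum>c'\<in>?N. 4 ^ h)"
    by (intro sum_mono order_trans[OF card_image_le]) (use Suc.IH in auto)
  also have "\<dots> \<le> 4 * 4 ^ h" using N(2) by simp
  finally show ?case using finite_subset[OF sub fin] by simp
qed

lemma tips_card: "finite (tips n h)" "card (tips n h) \<le> (2 * n + 1)\<^sup>2 * 4 ^ h"
proof -
  let ?W = "\<lambda>c. {xs. length xs = Suc h \<and> successively neighbors xs \<and> hd xs = c}"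
  have sub: "tips n h \<subseteq> (\<Union>c\<in>box (0, 0) (int n). ?W c)" by (auto simp: tips_def)
  have fin: "finite (\<Union>c\<in>box (0, 0) (int n). ?W c)" using neighbor_paths_card by auto
  show "finite (tips n h)" using sub fin by (rule finite_subset)
  have "card (tips n h) \<le> card (\<Union>c\<in>box (0, 0) (int n). ?W c)" by (rule card_mono[OF fin sub])
  also have "\<dots> \<le> (\<Sum>c\<in>box (0, 0) (int n). card (?W c))" by (rule card_UN_le) simp
  also have "\<dots> \<le> (\<Sum>c\<in>box (0, 0) (int n). 4 ^ h)" by (intro sum_mono) (use neighbor_paths_card in auto)
  also have "\<dots> = (2 * n + 1)\<^sup>2 * 4 ^ h"
    by (simp add: box_def card_cartesian_product power2_eq_square nat_add_distrib nat_mult_distrib)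
  finally show "card (tips n h) \<le> (2 * n + 1)\<^sup>2 * 4 ^ h" .
qed

text \<open>The inequality of arithmetic and geometric means: multiply the bounds
  \<open>v / c \<le> exp (v / c - 1)\<close>; the total exponent is nonpositive by the hypothesis on
  the sum.\<close>

lemma prod_list_le_power:
  fixes vs :: "real list"
  assumes "\<And>v. v \<in> set vs \<Longrightarrow> 0 \<le> v" "0 < c" "sum_list vs \<le> c * real (length vs)"
  shows "prod_list vs \<le> c ^ length vs"
proof -
  have "0 \<le> prod_list vs \<and> prod_list vs \<le> c ^ length vs * exp (sum_list vs / c - real (length vs))"
    using assms(1)
  proof (induction vs)
    case (Cons v vs)
    have "v / c \<le> exp (v / c - 1)" using exp_ge_add_one_self[of "v / c - 1"] by simp
    then have "v \<le> c * exp (v / c - 1)" using assms(2) by (simp add: field_simps)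
    then have "v * prod_list vs \<le> (c * exp (v / c - 1)) * (c ^ length vs * exp (sum_list vs / c - real (length vs)))"
      using Cons assms(2) by (intro mult_mono mult_nonneg_nonneg) auto
    also have "\<dots> = c ^ length (v # vs) * exp (sum_list (v # vs) / c - real (length (v # vs)))"
      by (simp add: exp_add[symmetric] exp_diff add_divide_distrib)
    finally show ?case using Cons by simp
  qed simp
  moreover have "exp (sum_list vs / c - real (length vs)) \<le> 1" using assms(2,3) by (simp add: field_simps)
  ultimately show ?thesis using assms(2)
    by (meson mult_left_le order_trans zero_le_power less_imp_le)
qed

lemma length_path_escapes: "length (path_escapes xs) = length xs - 1"
  by (induction xs rule: path_escapes.induct) auto

lemma path_escapes_nonneg: "v \<in> set (path_escapes xs) \<Longrightarrow> 0 \<le> v"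
  by (induction xs rule: path_escapes.induct) (auto intro!: escape_nonneg)

lemma prod_list_map_power2: "prod_list (map (\<lambda>v. v\<^sup>2) vs) = (prod_list vs)\<^sup>2" for vs :: "real list"
  by (induction vs) (auto simp: power_mult_distrib)

text \<open>Applied to the squares, whose mean is at most \<open>1568 * h\<close>. Rounding up to
  \<open>1600 = 40^2\<close> makes the square root clean.\<close>

lemma prod_path_escapes_le:
  assumes "xs \<in> tips n h" "0 < h"
  shows "prod_list (path_escapes xs) \<le> (40 * sqrt (real h)) ^ h"
proof -
  have len: "length (path_escapes xs) = h" using assms by (simp add: tips_def length_path_escapes)
  have "prod_list (map (\<lambda>v. v\<^sup>2) (path_escapes xs)) \<le> (1568 * real h) ^ length (map (\<lambda>v. v\<^sup>2) (path_escapes xs))"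
    using assms path_escapes_square_sum[of xs h]
    by (intro prod_list_le_power) (auto simp: len tips_def power2_eq_square)
  also have "\<dots> \<le> (1600 * real h) ^ h" unfolding length_map len by (intro power_mono) auto
  also have "1600 * real h = (40 * sqrt (real h))\<^sup>2" by (simp add: power_mult_distrib)
  also have "((40 * sqrt (real h))\<^sup>2) ^ h = ((40 * sqrt (real h)) ^ h)\<^sup>2" by (simp only: power_mult[symmetric] mult.commute)
  finally have "(prod_list (path_escapes xs))\<^sup>2 \<le> ((40 * sqrt (real h)) ^ h)\<^sup>2" by (simp add: prod_list_map_power2)
  then show ?thesis by (rule power2_le_imp_le) simp
qed

text \<open>The term \<open>h^h / fact h\<close> is one summand of the series for
  \<open>exp h\<close>, and the binomial coefficient times \<open>fact h\<close> is at most
  \<open>n^h\<close>.\<close>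

lemma binomial_le_exp_power:
  assumes "0 < h"
  shows "real (n choose h) \<le> (exp 1 * real n / real h) ^ h"
proof -
  have "(\<Sum>k\<in>{h}. real h ^ k / fact k) \<le> (\<Sum>k. real h ^ k / fact k)"
    using summable_exp[of "real h"] by (intro sum_le_suminf) (auto simp: field_simps)
  also have "\<dots> = exp (real h)" by (simp add: exp_def divide_inverse_commute)
  finally have "real h ^ h \<le> exp (real h) * fact h" by (simp add: field_simps)
  then have "real (n choose h) * real h ^ h \<le> real (n choose h) * (exp (real h) * fact h)"
    by (rule mult_left_mono) simp
  also have "\<dots> = exp (real h) * real ((n choose h) * fact h)" by simp
  also have "\<dots> \<le> exp (real h) * real (n ^ h)"
    by (intro mult_left_mono of_nat_mono binomial_fact_pow) auto
  also have "exp (real h) = exp 1 ^ h" by (simp add: exp_of_nat_mult[symmetric])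
  finally show ?thesis using assms by (simp add: power_mult_distrib power_divide field_simps)
qed

section \<open>Union bound over all paths from a high tip\<close>

context dla
begin

text \<open>The constant is \<open>4 * 8 * 40\<close>: four choices per path step, the factor in
  \<open>attach_prob_le\<close>, and the geometric mean of the escape potentials.\<close>

lemma prob_high_le:
  assumes "0 < h"
  shows "prob {\<omega> \<in> space M. \<exists>xs\<in>tips n h. chain (\<lambda>i. A i \<omega>) xs n} \<le>
    real ((2 * n + 1)\<^sup>2) * (1280 * exp 1 * real n * (1 + ln (real h)) * sqrt (real h) / (real h)\<^sup>2) ^ h"
proof -
  define c where "c = 8 * (1 + ln (real h)) / real h"
  define q where "q = exp 1 * real n / real h * c * (40 * sqrt (real h))"
  have c: "0 \<le> c" using assms by (simp add: c_def ln_ge_zero add_nonneg_nonneg)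
  have each: "prob {\<omega> \<in> space M. chain (\<lambda>i. A i \<omega>) xs n} \<le> q ^ h" if xs: "xs \<in> tips n h" for xs
  proof -
    have ne: "xs \<noteq> []" and len: "length xs = Suc h" and tip: "snd (hd xs) = 2 * int h"
      using xs by (auto simp: tips_def)
    have "int h \<le> snd x" if "x \<in> set xs" for x
    proof -
      have "x \<in> box (hd xs) (int h)" using path_in_box[OF ne] xs that len by (auto simp: tips_def)
      then show ?thesis using tip by (auto simp: in_box_iff)
    qed
    then have "prob {\<omega> \<in> space M. chain (\<lambda>i. A i \<omega>) xs n} \<le>
        real (n choose h) * c ^ h * prod_list (path_escapes xs)"
      using prob_chain_le[OF ne _ assms, of n] len by (simp add: c_def)
    also have "\<dots> \<le> (exp 1 * real n / real h) ^ h * c ^ h * (40 * sqrt (real h)) ^ h"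
      using c assms by (intro mult_mono binomial_le_exp_power prod_path_escapes_le[OF xs] prod_list_nonneg)
        (auto intro: path_escapes_nonneg)
    also have "\<dots> = q ^ h" by (simp only: q_def power_mult_distrib)
    finally show ?thesis .
  qed
  have "{\<omega> \<in> space M. \<exists>xs\<in>tips n h. chain (\<lambda>i. A i \<omega>) xs n} = (\<Union>xs\<in>tips n h. {\<omega> \<in> space M. chain (\<lambda>i. A i \<omega>) xs n})"
    by auto
  then have "prob {\<omega> \<in> space M. \<exists>xs\<in>tips n h. chain (\<lambda>i. A i \<omega>) xs n} \<le>
      (\<Sum>xs\<in>tips n h. prob {\<omega> \<in> space M. chain (\<lambda>i. A i \<omega>) xs n})"
    using tips_card(1) chain_measurable by (simp only:) (rule finite_measure_subadditive_finite, auto)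
  also have "\<dots> \<le> real (card (tips n h)) * q ^ h"
    using sum_mono[OF each] by simp
  also have "\<dots> \<le> real ((2 * n + 1)\<^sup>2 * 4 ^ h) * q ^ h"
    using tips_card(2)[of n h] c unfolding q_def of_nat_le_iff[symmetric, where 'a = real]
    by (intro mult_right_mono zero_le_power) auto
  also have "\<dots> = real ((2 * n + 1)\<^sup>2) * (4 * q) ^ h" by (simp add: power_mult_distrib)
  also have "4 * q = 1280 * exp 1 * real n * (1 + ln (real h)) * sqrt (real h) / (real h)\<^sup>2"
    by (simp add: q_def c_def power2_eq_square)
  finally show ?thesis .
qed

end

section \<open>Passage to heights and the Borel-Cantelli argument\<close>

lemma growth_height_less:
  assumes a: "growth a" and no: "\<not> (\<exists>xs\<in>tips n h. chain a xs n)" and x: "x \<in> a n"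
  shows "snd x < 2 * int h"
proof (rule ccontr)
  assume "\<not> snd x < 2 * int h"
  then have "int (2 * h) \<le> snd x" by simp
  from growth_intermediate_height[OF a x this] obtain y where y: "y \<in> a n" "snd y = int (2 * h)" by blast
  have "int h \<le> snd y" using y by simp
  from growth_chain[OF a y(1) this] obtain xs where
    "hd xs = y" "length xs = Suc h" "successively neighbors xs" "chain a xs n" by blast
  then have "xs \<in> tips n h" using y growth_box[OF a, of n] by (auto simp: tips_def)
  with no \<open>chain a xs n\<close> show False by blast
qed

text \<open>The powers combine to \<open>n powr (- 3 * \<epsilon> / 4)\<close>, which beats the
  logarithm.\<close>

lemma chain_rate_tendsto_0:
  fixes \<epsilon> :: real
  assumes "0 < \<epsilon>"
  shows "(\<lambda>n. 1280 * exp 1 * real n * (1 + ln (2 * real n powr (2 / 3 + \<epsilon> / 2))) *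
    (real n powr (2 / 3 + \<epsilon> / 2)) powr (- (3 / 2))) \<longlonglongrightarrow> 0"
  using assms by real_asymp

text \<open>The leading power left over is \<open>n powr (- \<epsilon> / 2)\<close>.\<close>

lemma height_scale_tendsto_0:
  fixes \<epsilon> :: real
  assumes "0 < \<epsilon>"
  shows "(\<lambda>n. real n powr (- \<epsilon> - 2 / 3) * (2 * (real n powr (2 / 3 + \<epsilon> / 2) + 1))) \<longlonglongrightarrow> 0"
  using assms by real_asymp

theorem theorem7:
  fixes M :: "'a measure" and A :: "nat \<Rightarrow> 'a \<Rightarrow> point set" and \<epsilon> :: real
  assumes "dla_process M A" and "\<epsilon> > 0"
  shows "AE \<omega> in M.
    limsup (\<lambda>n. ereal (real n powr (- \<epsilon> - 2 / 3) * real_of_int (cluster_height (A n \<omega>)))) = 0"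
proof -
  interpret prob_space M using assms(1) by (simp add: dla_process_def)
  interpret dla M A by unfold_locales (rule assms(1))
  \<comment> \<open>Half of \<open>\<epsilon>\<close> makes the chain probabilities summable; the
    other half sends the rescaled height to zero.\<close>
  define x where "x n = real n powr (2 / 3 + \<epsilon> / 2)" for n
  define h where "h n = nat \<lceil>x n\<rceil>" for n
  define E where "E n = {\<omega> \<in> space M. \<exists>xs\<in>tips n (h n). chain (\<lambda>i. A i \<omega>) xs n}" for n
  have x1: "1 \<le> x n" if "1 \<le> n" for n
    using that assms(2) by (simp add: x_def ge_one_powr_ge_zero)
  have h_ge: "x n \<le> real (h n)" for n unfolding h_def by linarith
  have h_le: "real (h n) \<le> x n + 1" for n unfolding h_def using powr_ge_zero[of "real n"] by (simp add: x_def)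
  have E: "E n \<in> events" for n
  proof -
    have "E n = (\<Union>xs\<in>tips n (h n). {\<omega> \<in> space M. chain (\<lambda>i. A i \<omega>) xs n})" by (auto simp: E_def)
    then show ?thesis using tips_card(1) chain_measurable by auto
  qed
  have "\<forall>\<^sub>F n in sequentially. 1280 * exp 1 * real n * (1 + ln (2 * x n)) * (x n) powr (- (3 / 2)) < exp (- 1)"
    unfolding x_def by (rule order_tendstoD(2)[OF chain_rate_tendsto_0[OF assms(2)]]) simp
  \<comment> \<open>A stretched exponential absorbs the quadratic number of tips and still leaves a
    summable bound.\<close>
  moreover have "\<forall>\<^sub>F n in sequentially. real ((2 * n + 1)\<^sup>2) * exp (- (real n powr (2 / 3))) \<le> 1 / real n ^ 2"
    by real_asymp
  moreover have "\<forall>\<^sub>F n in sequentially. 1 \<le> n" by (rule eventually_ge_at_top)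
  ultimately have bound: "\<forall>\<^sub>F n in sequentially. prob (E n) \<le> 1 / real n ^ 2"
  proof eventually_elim
    case (elim n)
    have x: "1 \<le> x n" using elim(3) by (rule x1)
    then have h: "0 < h n" using h_ge[of n] by simp
    have "sqrt (real (h n)) / (real (h n))\<^sup>2 = real (h n) powr (- (3 / 2))"
    proof -
      have r: "sqrt (real (h n)) = real (h n) powr (1 / 2)" "(real (h n))\<^sup>2 = real (h n) powr 2"
        using h by (simp_all add: powr_half_sqrt powr_numeral)
      show ?thesis unfolding r powr_diff[symmetric] by simp
    qed
    also have "\<dots> \<le> x n powr (- (3 / 2))" using x h_ge by (intro powr_mono2') auto
    finally have s: "sqrt (real (h n)) / (real (h n))\<^sup>2 \<le> x n powr (- (3 / 2))" .
    \<comment> \<open>The factor \<open>2\<close> in the logarithm covers the rounding, as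
      \<open>h n \<le> x n + 1 \<le> 2 * x n\<close>.\<close>
    have l: "1 + ln (real (h n)) \<le> 1 + ln (2 * x n)" using h h_le[of n] x by simp
    have l0: "0 \<le> 1 + ln (real (h n))" using h by (simp add: ln_ge_zero add_nonneg_nonneg)
    have "1280 * exp 1 * real n * (1 + ln (real (h n))) * sqrt (real (h n)) / (real (h n))\<^sup>2 =
        1280 * exp 1 * real n * (1 + ln (real (h n))) * (sqrt (real (h n)) / (real (h n))\<^sup>2)" by simp
    also have "\<dots> \<le> 1280 * exp 1 * real n * (1 + ln (2 * x n)) * x n powr (- (3 / 2))"
      using s l l0 by (intro mult_mono mult_nonneg_nonneg) auto
    also have "\<dots> \<le> exp (- 1)" using elim(1) by simp
    finally have q: "1280 * exp 1 * real n * (1 + ln (real (h n))) * sqrt (real (h n)) / (real (h n))\<^sup>2 \<le> exp (- 1)" .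
    have "prob (E n) \<le> real ((2 * n + 1)\<^sup>2) *
        (1280 * exp 1 * real n * (1 + ln (real (h n))) * sqrt (real (h n)) / (real (h n))\<^sup>2) ^ h n"
      unfolding E_def by (rule prob_high_le[OF h])
    also have "\<dots> \<le> real ((2 * n + 1)\<^sup>2) * exp (- 1) ^ h n"
      using q l0 by (intro mult_left_mono power_mono divide_nonneg_nonneg mult_nonneg_nonneg) auto
    also have "exp (- 1) ^ h n = exp (- real (h n))" by (simp add: exp_of_nat_mult[symmetric])
    also have "\<dots> \<le> exp (- (real n powr (2 / 3)))"
    proof -
      have "real n powr (2 / 3) \<le> x n" unfolding x_def using elim(3) assms(2) by (intro powr_mono) auto
      then show ?thesis using h_ge[of n] by simp
    qed
    also have "real ((2 * n + 1)\<^sup>2) * exp (- (real n powr (2 / 3))) \<le> 1 / real n ^ 2" by (rule elim(2))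
    finally show ?case by (simp add: mult_left_mono)
  qed
  have "summable (\<lambda>n. prob (E n))"
  proof (rule summable_comparison_test_ev)
    show "\<forall>\<^sub>F n in sequentially. norm (prob (E n)) \<le> 1 / real n ^ 2" using bound by simp
    show "summable (\<lambda>n. 1 / real n ^ 2)" using inverse_power_summable[of 2, where 'a = real] by (simp add: inverse_eq_divide)
  qed
  then have "AE \<omega> in M. \<forall>\<^sub>F n in sequentially. \<omega> \<in> space M - E n"
    by (intro borel_cantelli_AE1 E) (auto simp: emeasure_eq_measure suminf_ennreal_eq)
  then show ?thesis using AE_growth
  proof eventually_elim
    case (elim \<omega>)
    have small: "\<forall>\<^sub>F n in sequentially. real n powr (- \<epsilon> - 2 / 3) * real_of_int (cluster_height (A n \<omega>)) \<le>
        real n powr (- \<epsilon> - 2 / 3) * (2 * (x n + 1))"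
      using elim(1)
    proof eventually_elim
      case (elim n)
      have "snd z < 2 * int (h n)" if "z \<in> A n \<omega>" for z
        using elim growth_height_less[OF \<open>growth (\<lambda>n. A n \<omega>)\<close> _ that] by (auto simp: E_def)
      then have "cluster_height (A n \<omega>) < 2 * int (h n)"
        unfolding cluster_height_def
        using growth_finite[OF \<open>growth (\<lambda>n. A n \<omega>)\<close>, of n] growth_origin[OF \<open>growth (\<lambda>n. A n \<omega>)\<close>, of n]
        by (subst Max_less_iff) auto
      then have "real_of_int (cluster_height (A n \<omega>)) \<le> 2 * real (h n)" by linarith
      also have "\<dots> \<le> 2 * (x n + 1)" using h_le[of n] by simp
      finally show ?case by (rule mult_left_mono) simp
    qed
    have nonneg: "0 \<le> real n powr (- \<epsilon> - 2 / 3) * real_of_int (cluster_height (A n \<omega>))" for n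
    proof -
      \<comment> \<open>The origin belongs to every cluster, so heights are nonnegative and the
        upper bound alone forces the limit zero.\<close>
      have "snd (0 :: int, 0 :: int) \<le> cluster_height (A n \<omega>)"
        unfolding cluster_height_def
        by (intro Max_ge finite_imageI imageI growth_finite[OF elim(2)] growth_origin[OF elim(2)])
      then show ?thesis by simp
    qed
    have "(\<lambda>n. real n powr (- \<epsilon> - 2 / 3) * real_of_int (cluster_height (A n \<omega>))) \<longlonglongrightarrow> 0"
      by (rule tendsto_sandwich[OF _ small tendsto_const height_scale_tendsto_0[OF assms(2), folded x_def]])
         (simp add: nonneg)
    then have "(\<lambda>n. ereal (real n powr (- \<epsilon> - 2 / 3) * real_of_int (cluster_height (A n \<omega>)))) \<longlonglongrightarrow> ereal 0"
      by simp
    then show ?case by (intro lim_imp_Limsup) (auto simp: zero_ereal_def)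
  qed
qed

end
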